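(* Let $n\ge 2$ and $m\ge 1$ be integers. Let $F:\mathbb{B}^n\to\mathbb{R}^{m+1}$ be a harmonic mapping such that $F(\mathbb{B}^n)\subset\mathbb{B}^{m+1}$ and $F(0)=(a,b)$, where $a\in\mathbb{R}^m$ and $b\in\mathbb{R}$. Let $e$ be a unit vector in $\mathbb{R}^{m+1}$, let $e_0=(1,0,\dots,0)\in\mathbb{R}^{m+1}$, and let $Q_e$ be an orthogonal $(m+1)\times(m+1)$ matrix such that $eQ_e=e_0$. Then for $0<r<1$ and $\omega\in S$, $$\langle F(r\omega),e\rangle\le\langle F_{(a,b)Q_e,r}(rN),e_0\rangle,$$ with equality at some point $r\omega$ if and only if $F(x)=F_{(a,b)Q_e,r}(xA)\,Q_e^{-1}$ for all $x\in\mathbb{B}^n$, where $A$ is an orthogonal $n\times n$ matrix such that $\omega A=N$. Furthermore, $\langle F(x),e\rangle<\langle F_{(a,b)Q_e,r}(rN),e_0\rangle$ for $|x|<r$.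
   Context: Vectors are row vectors and matrices act on the right; $|\cdot|$ and $\langle\cdot,\cdot\rangle$ are the Euclidean norm and inner product. $\mathbb{B}^k$ is the open unit ball of $\mathbb{R}^k$, $S$ is the unit sphere in $\mathbb{R}^n$, $\sigma$ is surface-area measure on $S$ normalized so that $\sigma(S)=1$, and $N=(0,\dots,0,1)\in S$. A mapping into $\mathbb{R}^{m+1}$ is harmonic if each of its components is $C^2$ with zero Laplacian. Definition of $F_{a,b,r}$, for $a\in\mathbb{R}^m$, $b\in\mathbb{R}$, $|a|^2+b^2<1$, $0<r<1$. Let $l=(1,0,\dots,0)\in\mathbb{R}^m$. For $b\ge 0$ let $\mathcal{U}_{a,b}$ be the class of (real vector-valued) $u\in(L^\infty(S))^m$ with $\|u\|_\infty\le 1$ (i.e. $|u(\omega)|\le 1$ a.e.), $\int_S u\,d\sigma=a$ and $\int_S\sqrt{1-|u(\omega)|^2}\,d\sigma\ge b$. Let $L_r(u)=\int_S\frac{1-r^2}{|rN-\omega|^n}\langle u(\omega),l\rangle\,d\sigma$. There is a unique (up to a.e. equality) element $u_{a,b,r}\in\mathcal{U}_{a,b}$ at which $L_r$ attains its maximum on $\mathcal{U}_{a,b}$. Put $v_{a,b,r}(\omega)=\sqrt{1-|u_{a,b,r}(\omega)|^2}$ and, for $x\in\mathbb{B}^n$, $$U_{a,b,r}(x)=\int_S\frac{1-|x|^2}{|x-\omega|^n}u_{a,b,r}(\omega)\,d\sigma,\qquad V_{a,b,r}(x)=\int_S\frac{1-|x|^2}{|x-\omega|^n}v_{a,b,r}(\omega)\,d\sigma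 .$$ For $b<0$ put $U_{a,b,r}=U_{a,-b,r}$ and $V_{a,b,r}=-V_{a,-b,r}$. Finally $F_{a,b,r}(x)=(U_{a,b,r}(x),V_{a,b,r}(x))\in\mathbb{R}^{m+1}$. The notation $F_{(a,b)Q_e,r}$ means $F_{a',b',r}$ where $(a',b')=(a,b)Q_e$ with $a'\in\mathbb{R}^m$, $b'\in\mathbb{R}$. *)

theory Defs
  imports "HOL-Analysis.Analysis"
begin

(* For an open set U the Frechet derivatives at interior points determine the partial derivatives,
   so the values of f outside U play no role below. *)

definition partial_deriv :: "'n \<Rightarrow> (real^'n \<Rightarrow> real) \<Rightarrow> real^'n \<Rightarrow> real" where
  "partial_deriv i f x = frechet_derivative f (at x) (axis i 1)"

definition C2_on :: "(real^'n) set \<Rightarrow> (real^'n \<Rightarrow> real) \<Rightarrow> bool" where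
  "C2_on U f \<longleftrightarrow>
     f differentiable_on U \<and>
     (\<forall>i. partial_deriv i f differentiable_on U) \<and>
     (\<forall>i j. continuous_on U (partial_deriv j (partial_deriv i f)))"

definition laplacian :: "(real^'n \<Rightarrow> real) \<Rightarrow> real^'n \<Rightarrow> real" where
  "laplacian f x = (\<Sum>i\<in>UNIV. partial_deriv i (partial_deriv i f) x)"

definition harmonic_map_on :: "(real^'n) set \<Rightarrow> (real^'n \<Rightarrow> real^'k) \<Rightarrow> bool" where
  "harmonic_map_on U F \<longleftrightarrow>
     (\<forall>k. C2_on U (\<lambda>x. F x $ k) \<and> (\<forall>x\<in>U. laplacian (\<lambda>x. F x $ k) x = 0))"

(* The coordinates of real^'n are ordered by the linear order on 'n, so that "first" and "last"
   coordinate make sense. *)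

definition first_unit :: "real^'m::{finite,linorder}" where
  "first_unit = axis (Min UNIV) 1"

definition north :: "real^'n::{finite,linorder}" where
  "north = axis (Max UNIV) 1"

(* R^(m+1) is real^('m+1), where 'm+1 is the disjoint sum of 'm with a one-element type; the
   extra index Inr 1 is the last coordinate. *)

definition join :: "real^'m \<Rightarrow> real \<Rightarrow> real^('m::finite + 1)" where
  "join a b = (\<chi> i. case i of Inl j \<Rightarrow> a $ j | Inr _ \<Rightarrow> b)"

definition init_part :: "real^('m::finite + 1) \<Rightarrow> real^'m" where
  "init_part w = (\<chi> j. w $ Inl j)"

definition last_part :: "real^('m::finite + 1) \<Rightarrow> real" where
  "last_part w = w $ Inr 1"

definition e0 :: "real^('m::{finite,linorder} + 1)" where
  "e0 = join first_unit 0"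

lemma join_parts: "join (init_part w) (last_part w) = w"
  by (auto simp: join_def init_part_def last_part_def vec_eq_iff split: sum.split)

lemma init_part_join [simp]: "init_part (join a b) = a"
  by (simp add: join_def init_part_def vec_eq_iff)

lemma last_part_join [simp]: "last_part (join a b) = b"
  by (simp add: join_def last_part_def)

(* Normalized surface area of a Borel set A of the unit sphere is the relative volume in the unit
   ball of the cone over A (see emeasure_sphere_measure): the measure is the image of the uniform
   distribution on the ball under x |-> x / norm x, which is sgn in the library. *)

definition sphere_measure :: "(real^'n) measure" where
  "sphere_measure =
     restrict_space (distr (uniform_measure lborel (ball 0 1)) borel sgn) (sphere 0 1)"

lemma space_sphere_measure: "space (sphere_measure :: (real^'n) measure) = sphere 0 1"
  by (simp add: sphere_measure_def space_restrict_space)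

lemma sets_sphere_measure:
  "sets (sphere_measure :: (real^'n) measure) = sets (restrict_space borel (sphere 0 1))"
  by (simp add: sphere_measure_def sets_restrict_space)

lemma emeasure_sphere_measure:
  fixes A :: "(real^'n) set"
  assumes "A \<in> sets borel" "A \<subseteq> sphere 0 1"
  shows "emeasure sphere_measure A =
    emeasure lborel {t *\<^sub>R w |t w. 0 < t \<and> t < 1 \<and> w \<in> A} / emeasure lborel (ball 0 1 :: (real^'n) set)"
proof -
  have cone: "ball 0 1 \<inter> sgn -` A = {t *\<^sub>R w |t w. 0 < t \<and> t < 1 \<and> w \<in> A}" (is "?L = ?R")
  proof
    show "?L \<subseteq> ?R"
    proof
      fix x assume x: "x \<in> ?L"
      then have "sgn x \<in> sphere 0 1" using assms by auto
      then have "x \<noteq> 0" by auto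
      then have "x = norm x *\<^sub>R sgn x" by (simp add: sgn_div_norm)
      with x \<open>x \<noteq> 0\<close> show "x \<in> ?R"
        by (intro CollectI exI[of _ "norm x"] exI[of _ "sgn x"]) auto
    qed
    show "?R \<subseteq> ?L"
    proof
      fix x assume "x \<in> ?R"
      then obtain t w where "x = t *\<^sub>R w" "0 < t" "t < 1" "w \<in> A" by auto
      moreover then have "norm w = 1" using assms by auto
      ultimately show "x \<in> ?L" by (simp add: sgn_div_norm)
    qed
  qed
  have m: "sgn -` A \<in> sets (borel :: (real^'n) measure)"
    using measurable_sets[OF borel_measurable_sgn assms(1)] by simp
  have "emeasure sphere_measure A = emeasure (distr (uniform_measure lborel (ball 0 1)) borel sgn) A"
    unfolding sphere_measure_def using assms by (intro emeasure_restrict_space) auto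
  also have "\<dots> = emeasure (uniform_measure lborel (ball 0 1)) (sgn -` A)"
    using assms by (subst emeasure_distr) (auto simp: measurable_def[of "uniform_measure _ _"] 
        intro: measurable_sets[OF borel_measurable_sgn, simplified])
  also have "\<dots> = emeasure lborel (ball 0 1 \<inter> sgn -` A) / emeasure lborel (ball 0 1 :: (real^'n) set)"
    using m by (intro emeasure_uniform_measure) auto
  finally show ?thesis unfolding cone .
qed

lemma emeasure_sphere_measure_sphere:
  "emeasure (sphere_measure :: (real^'n) measure) (sphere 0 1) = 1"
proof -
  let ?B = "ball 0 1 :: (real^'n) set"
  have "{t *\<^sub>R w |t w. 0 < t \<and> t < 1 \<and> w \<in> sphere 0 1} = ?B - {0}" (is "?L = _")
  proof
    show "?L \<subseteq> ?B - {0}" by auto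
    show "?B - {0} \<subseteq> ?L"
    proof
      fix x assume x: "x \<in> ?B - {0}"
      then have "x = norm x *\<^sub>R sgn x" by (simp add: sgn_div_norm)
      with x show "x \<in> ?L"
        by (intro CollectI exI[of _ "norm x"] exI[of _ "sgn x"]) (auto simp: norm_sgn)
    qed
  qed
  then have "emeasure (sphere_measure :: (real^'n) measure) (sphere 0 1) =
      emeasure lborel (?B - {0}) / emeasure lborel ?B"
    by (subst emeasure_sphere_measure) auto
  also have "emeasure lborel (?B - {0}) = emeasure lborel ?B"
    by (subst emeasure_Diff_null_set) auto
  also have "emeasure lborel ?B / emeasure lborel ?B = 1"
  proof (rule ennreal_divide_self)
    show "emeasure lborel ?B \<noteq> 0"
      using content_ball_pos[of 1 "0 :: real^'n"] emeasure_lborel_ball_finite[of "0 :: real^'n" 1]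
      by (auto simp: measure_def)
    show "emeasure lborel ?B < top"
      using emeasure_lborel_ball_finite[of "0 :: real^'n" 1] by simp
  qed
  finally show ?thesis .
qed

definition admissible :: "real^'m \<Rightarrow> real \<Rightarrow> (real^'n \<Rightarrow> real^'m) set" where
  "admissible a b =
     {u. u \<in> borel_measurable sphere_measure \<and>
         (AE w in sphere_measure. norm (u w) \<le> 1) \<and>
         (LINT w|sphere_measure. u w) = a \<and>
         (LINT w|sphere_measure. sqrt (1 - (norm (u w))\<^sup>2)) \<ge> b}"

definition L_functional :: "real \<Rightarrow> (real^'n::{finite,linorder} \<Rightarrow> real^'m::{finite,linorder}) \<Rightarrow> real" where
  "L_functional r u = (LINT w|sphere_measure.
     (1 - r\<^sup>2) / norm (r *\<^sub>R north - w) ^ CARD('n) * (u w \<bullet> first_unit))"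

(* For b >= 0.  The maximizer is unique only up to equality almost everywhere; arg_max_on picks one
   representative, and the integrals below do not depend on the choice. *)

definition extremal ::
    "real^'m::{finite,linorder} \<Rightarrow> real \<Rightarrow> real \<Rightarrow> real^'n::{finite,linorder} \<Rightarrow> real^'m::{finite,linorder}"
  where
  "extremal a b r =
     arg_max_on (L_functional r) (admissible a b)"

definition poisson :: "(real^'n \<Rightarrow> 'b) \<Rightarrow> real^'n \<Rightarrow> 'b::{banach,second_countable_topology}" where
  "poisson u x = (LINT w|sphere_measure. ((1 - (norm x)\<^sup>2) / norm (x - w) ^ CARD('n)) *\<^sub>R u w)"

definition U_ext ::
    "real^'m::{finite,linorder} \<Rightarrow> real \<Rightarrow> real \<Rightarrow> real^'n::{finite,linorder} \<Rightarrow> real^'m::{finite,linorder}"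
  where
  "U_ext a b r = (if b \<ge> 0 then poisson (extremal a b r) else poisson (extremal a (- b) r))"

definition V_ext ::
    "real^'m::{finite,linorder} \<Rightarrow> real \<Rightarrow> real \<Rightarrow> real^'n::{finite,linorder} \<Rightarrow> real"
  where
  "V_ext a b r x =
     (if b \<ge> 0 then poisson (\<lambda>w. sqrt (1 - (norm (extremal a b r w))\<^sup>2)) x
      else - poisson (\<lambda>w. sqrt (1 - (norm (extremal a (- b) r w))\<^sup>2)) x)"

definition F_ext ::
    "real^('m::{finite,linorder} + 1) \<Rightarrow> real \<Rightarrow> real^'n::{finite,linorder} \<Rightarrow> real^('m::{finite,linorder} + 1)"
  where
  "F_ext c r x =
     join (U_ext (init_part c) (last_part c) r x) (V_ext (init_part c) (last_part c) r x)"

end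

theory Submission
  imports Defs
begin

text \<open>
  The second difference quotients of a harmonic function tend to the Laplacian, which is enough for
  the weak maximum principle; with the explicit Laplacian of the Poisson kernel this gives
  \<open>F (\<rho> x) = poisson (\<lambda>w. F (\<rho> w)) x\<close> for \<open>\<rho> < 1\<close>, without any boundary values.

  The extremal problem is solved by convex duality. Let \<open>K\<close> be the Poisson kernel at \<open>r N\<close> and \<open>p\<close> with
  \<open>|p| < 1\<close> the prescribed mean. The convex function \<open>y \<mapsto> \<integral>|K e0 + y| - y \<bullet> p\<close> is coercive, and at a minimum
  \<open>y\<close> the unit field \<open>f = (K e0 + y) / |K e0 + y|\<close> has mean \<open>p\<close>. For every competitor \<open>g\<close> with \<open>|g| \<le> 1\<close>,
  \<open>\<integral>(K e0 + y) \<bullet> g \<le> \<integral>|K e0 + y| = \<integral>(K e0 + y) \<bullet> f\<close>, with equality only if \<open>g = f\<close> almost everywhere.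
  Hence the first component of \<open>f\<close> is the extremal function \<open>u\<close> and \<open>F_ext p r = poisson f\<close>.

  Applied to \<open>w \<mapsto> F (\<rho> w)\<close> and \<open>\<rho> \<rightarrow> 1\<close> this gives the inequality. In the case of equality these maps form
  a maximizing sequence, so a subsequence converges to \<open>f\<close> almost everywhere and \<open>F = poisson f\<close>.
\<close>

section \<open>Rotations and the sphere measure\<close>

text \<open>\<open>admissible\<close> constrains the mean of \<open>sqrt (1 - |u|^2)\<close> by an
  inequality, whereas the duality fixes a mean in one more dimension. The two meet because
  \<open>e0\<close> has last coordinate 0: the last coordinate of \<open>K e0 + y\<close> is that of
  \<open>y\<close>, a constant. So the last coordinate of \<open>f\<close> has one sign, equals
  \<open>sqrt (1 - |u|^2)\<close> up to that sign, and the constant is a multiplier of the right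
  sign for the inequality. Dividing by \<open>|K e0 + y|\<close> is legitimate almost everywhere
  because a level set of the kernel lies in a latitude of the sphere, a null set in dimension at
  least 2; on a two-point sphere it would carry mass. Second differences are linear in the function
  and pass through a Poisson integral by dominated convergence, so no such integral is ever
  differentiated. The Poisson representation, unlike the Laplacian, is visibly stable under
  orthogonal maps on both sides; this reduces general directions to \<open>e0\<close> and
  \<open>north\<close>. The strict inequality inside radius \<open>r\<close> is a maximum principle
  on the sphere of radius \<open>r\<close>, where the mean falls below the bound since a constant of
  norm less than 1 is never optimal.\<close>

text \<open>
  The library proves rotation invariance of Lebesgue measure only for well-ordered index types.
  Here an open set is exhausted by disjoint balls (Vitali), and these are mapped to balls of the same radius.
\<close>

lemma emeasure_lborel_orthogonal_vimage_open:
  fixes T :: "'a::euclidean_space \<Rightarrow> 'a"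
  assumes T: "orthogonal_transformation T" and U: "open U"
  shows "emeasure lborel (T -` U) = emeasure lborel U"
proof -
  have lin: "linear T" and inj: "inj T" and surj: "surj T"
    by (fact orthogonal_transformation_linear[OF T] orthogonal_transformation_inj[OF T]
        orthogonal_transformation_surj[OF T])+
  have bl: "bounded_linear T" using lin by (rule linear_conv_bounded_linear[THEN iffD1])
  have cont: "continuous_on UNIV T" by (intro linear_continuous_on bl)
  have opT: "open (T -` U)" using cont U by (simp add: open_vimage)
  have imU: "T ` (T -` U) = U" using surj by auto
  let ?K = "{(x, r). 0 < r \<and> ball x r \<subseteq> T -` U}"
  have fine: "\<exists>i. i \<in> ?K \<and> x \<in> ball (fst i) (snd i) \<and> snd i < d" if x: "x \<in> T -` U" "0 < d" for x d
  proof -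
    obtain k where "k > 0" "ball x k \<subseteq> T -` U" using opT x(1) openE by blast
    \<comment> \<open>A Vitali cover needs arbitrarily small balls at every point;
      \<open>d/2\<close> keeps the radius strictly below \<open>d\<close>.\<close>
    then have "(x, min k (d/2)) \<in> ?K" using x(2) by auto
    then show ?thesis using \<open>k > 0\<close> x(2) by (intro exI[of _ "(x, min k (d/2))"]) auto
  qed
  obtain C where C: "countable C" "C \<subseteq> ?K"
      and dis: "pairwise (\<lambda>i j. disjnt (ball (fst i) (snd i)) (ball (fst j) (snd j))) C"
      and neg: "negligible (T -` U - (\<Union>i\<in>C. ball (fst i) (snd i)))"
    by (rule Vitali_covering_theorem_balls[of "T -` U" ?K fst snd, OF fine]) (assumption | rule that)+
  let ?B = "\<lambda>i. ball (fst i) (snd i)"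
  have Tball: "T ` ball x r = ball (T x) r" for x r
    using image_orthogonal_transformation_ball[OF T] by simp
  have df: "disjoint_family_on ?B C"
    using dis by (auto simp: disjoint_family_on_def pairwise_def disjnt_def)
  have df': "disjoint_family_on (\<lambda>i. T ` ?B i) C"
    using df inj by (auto simp: disjoint_family_on_def image_Int[symmetric])
  have sub: "(\<Union>i\<in>C. ?B i) \<subseteq> T -` U" using C(2) by (fastforce simp del: vimage_eq)
  have eq: "emeasure lborel V = emeasure lborel W"
    if "open V" "W \<subseteq> V" "open W" "negligible (V - W)" for V W :: "'a set"
  proof -
    have "V - W \<in> null_sets lborel"
      using that by (auto simp: negligible_iff_null_sets null_sets_completion_iff)
    then have "emeasure lborel (W \<union> (V - W)) = emeasure lborel W"
      using that by (intro emeasure_Un_null_set) auto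
    moreover have "W \<union> (V - W) = V" using that by auto
    ultimately show ?thesis by simp
  qed
  have imsub: "T ` (\<Union>i\<in>C. ?B i) \<subseteq> U" using image_mono[OF sub, of T] imU by simp
  have opim: "open (T ` (\<Union>i\<in>C. ?B i))" by (simp add: image_UN Tball open_UN)
  have n2: "negligible (U - T ` (\<Union>i\<in>C. ?B i))"
  proof -
    have "U - T ` (\<Union>i\<in>C. ?B i) = T ` (T -` U - (\<Union>i\<in>C. ?B i))"
      using imU inj by (subst image_set_diff) auto
    then show ?thesis using negligible_differentiable_image_negligible[OF order.refl neg, of T]
        linear_imp_differentiable_on[OF lin] by simp
  qed
  have "emeasure lborel (T -` U) = emeasure lborel (\<Union>i\<in>C. ?B i)"
    using sub opT neg by (intro eq) auto
  also have "\<dots> = (\<integral>\<^sup>+i. emeasure lborel (?B i) \<partial>count_space C)"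
    using df C by (intro emeasure_UN_countable) auto
  also have "\<dots> = (\<integral>\<^sup>+i. emeasure lborel (T ` ?B i) \<partial>count_space C)"
  proof (intro nn_integral_cong)
    fix i assume "i \<in> space (count_space C)"
    then have "0 < snd i" using C by auto
    then show "emeasure lborel (?B i) = emeasure lborel (T ` ?B i)"
      unfolding Tball by (simp add: emeasure_ball)
  qed
  also have "\<dots> = emeasure lborel (\<Union>i\<in>C. T ` ?B i)"
    using df' C by (intro emeasure_UN_countable[symmetric]) (auto simp: Tball)
  also have "(\<Union>i\<in>C. T ` ?B i) = T ` (\<Union>i\<in>C. ?B i)" by auto
  also have "emeasure lborel (T ` (\<Union>i\<in>C. ?B i)) = emeasure lborel U"
    by (intro eq[symmetric] U imsub opim n2)
  finally show ?thesis .
qed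

text \<open>Lebesgue measure is determined by its values on open boxes, so the invariance for open
  sets suffices.\<close>

lemma lborel_distr_orthogonal:
  fixes T :: "'a::euclidean_space \<Rightarrow> 'a"
  assumes T: "orthogonal_transformation T"
  shows "distr lborel borel T = lborel"
proof (rule lborel_eqI[symmetric])
  have m: "T \<in> borel_measurable borel"
    using orthogonal_transformation_linear[OF T]
    by (intro borel_measurable_continuous_onI linear_continuous_on)
       (simp add: linear_conv_bounded_linear)
  fix l u :: 'a assume "\<And>b. b \<in> Basis \<Longrightarrow> l \<bullet> b \<le> u \<bullet> b"
  then show "emeasure (distr lborel borel T) (box l u) = (\<Prod>b\<in>Basis. (u - l) \<bullet> b)"
    using m by (simp add: emeasure_distr emeasure_lborel_orthogonal_vimage_open[OF T]
        emeasure_lborel_box open_box)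
qed simp

section \<open>Surface measure as a rotation-invariant probability measure\<close>

global_interpretation sphere: finite_measure "sphere_measure :: (real^'n) measure"
  by standard (simp add: space_sphere_measure emeasure_sphere_measure_sphere)

lemma measure_sphere_measure [simp]: "measure (sphere_measure :: (real^'n) measure) (sphere 0 1) = 1"
  by (simp add: measure_def emeasure_sphere_measure_sphere)

lemma borel_measurable_sphere_measure:
  "(f :: real^'n \<Rightarrow> 'a::topological_space) \<in> borel_measurable sphere_measure
    \<longleftrightarrow> f \<in> borel_measurable (restrict_space borel (sphere 0 1))"
  by (intro iffI; subst measurable_cong_sets; (assumption)?)
     (auto simp: sets_sphere_measure)

lemma continuous_on_sphere_measurable:
  fixes f :: "real^'n \<Rightarrow> 'a::topological_space"
  shows "continuous_on (sphere 0 1) f \<Longrightarrow> f \<in> borel_measurable sphere_measure"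
  by (simp add: borel_measurable_sphere_measure borel_measurable_continuous_on_restrict)

lemma AE_sphere_norm: "AE w in (sphere_measure :: (real^'n) measure). norm w = 1"
  by (rule AE_I2) (simp add: space_sphere_measure)

lemma orthogonal_vector_matrix:
  fixes A :: "real^'n^'n"
  assumes "orthogonal_matrix A"
  shows "orthogonal_transformation (\<lambda>x. x v* A)"
proof -
  have "orthogonal_transformation (\<lambda>x. transpose A *v x)"
    using assms
    by (subst orthogonal_transformation_matrix) (simp add: matrix_of_matrix_vector_mul orthogonal_matrix_transpose del: transpose_matrix_vector)
  then show ?thesis by simp
qed

text \<open>The preimage form makes the cone over a Borel set visibly Borel, and it is the form that
  commutes with rotations.\<close>

lemma sphere_cone_eq:
  fixes Y :: "'a::real_normed_vector set"
  assumes Y: "Y \<subseteq> sphere 0 1"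
  shows "{t *\<^sub>R w |t w. 0 < t \<and> t < 1 \<and> w \<in> Y} = ball 0 1 \<inter> sgn -` Y"
proof (intro equalityI subsetI)
  fix x assume "x \<in> {t *\<^sub>R w |t w. 0 < t \<and> t < 1 \<and> w \<in> Y}"
  then obtain t w where "x = t *\<^sub>R w" "0 < t" "t < 1" "w \<in> Y" by auto
  moreover then have "norm w = 1" using Y by auto
  ultimately show "x \<in> ball 0 1 \<inter> sgn -` Y" by (simp add: sgn_div_norm)
next
  fix x assume x: "x \<in> ball 0 1 \<inter> sgn -` Y"
  then have "sgn x \<in> sphere 0 1" using Y by auto
  then have "x \<noteq> 0" by auto
  then show "x \<in> {t *\<^sub>R w |t w. 0 < t \<and> t < 1 \<and> w \<in> Y}"
    using x by (intro CollectI exI[of _ "norm x"] exI[of _ "sgn x"]) (auto simp: sgn_div_norm)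
qed

lemma measurable_sphere_orthogonal:
  fixes T :: "real^'n \<Rightarrow> real^'n"
  assumes T: "orthogonal_transformation T"
  shows "T \<in> measurable sphere_measure sphere_measure"
proof -
  have "linear T" and nT: "\<And>x. norm (T x) = norm x"
    using T by (auto simp: orthogonal_transformation)
  then have "continuous_on (sphere 0 1) T"
    by (simp add: linear_continuous_on linear_conv_bounded_linear)
  then have "T \<in> measurable (restrict_space borel (sphere 0 1)) (restrict_space borel (sphere 0 1))"
    using borel_measurable_continuous_on_restrict nT
    by (intro measurable_restrict_space2) (auto simp: space_restrict_space)
  then show ?thesis
    by (subst measurable_cong_sets[OF sets_sphere_measure sets_sphere_measure])
qed

lemma sphere_measure_distr_orthogonal:
  fixes T :: "real^'n \<Rightarrow> real^'n"
  assumes T: "orthogonal_transformation T"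
  shows "distr sphere_measure sphere_measure T = sphere_measure"
proof (rule measure_eqI)
  have lin: "linear T" and nT: "\<And>x. norm (T x) = norm x"
    using T by (auto simp: orthogonal_transformation)
  have ct: "continuous_on X T" for X
    using lin by (simp add: linear_continuous_on linear_conv_bounded_linear)
  have mb: "T \<in> borel_measurable borel" using ct by (rule borel_measurable_continuous_onI)
  note ms = measurable_sphere_orthogonal[OF T]
  show "sets (distr sphere_measure sphere_measure T) = sets (sphere_measure :: (real^'n) measure)"
    by simp
  fix X assume "X \<in> sets (distr sphere_measure (sphere_measure :: (real^'n) measure) T)"
  then have X: "X \<in> sets (sphere_measure :: (real^'n) measure)" by simp
  then have X': "X \<in> sets borel" "X \<subseteq> sphere 0 1"
    by (auto simp: sets_sphere_measure sets_restrict_space)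
  have pre: "T -` X \<inter> space sphere_measure = T -` X"
    using X' nT by (auto simp: space_sphere_measure)
  have TX: "T -` X \<in> sets borel" "T -` X \<subseteq> sphere 0 1"
    using measurable_sets[OF mb X'(1)] X'(2) nT by auto
  have sb: "ball 0 1 \<inter> sgn -` X \<in> sets borel"
    using measurable_sets[OF borel_measurable_sgn X'(1)] by simp
  have Tc: "ball 0 1 \<inter> sgn -` (T -` X) = T -` (ball 0 1 \<inter> sgn -` X)"
    using nT lin by (auto simp: sgn_div_norm linear_scale)
  have "emeasure (distr sphere_measure sphere_measure T) X = emeasure sphere_measure (T -` X)"
    using X ms pre by (simp add: emeasure_distr)
  also have "\<dots> = emeasure lborel (T -` (ball 0 1 \<inter> sgn -` X)) / emeasure lborel (ball 0 1 :: (real^'n) set)"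
    by (simp only: emeasure_sphere_measure[OF TX] sphere_cone_eq[OF TX(2)] Tc)
  also have "emeasure lborel (T -` (ball 0 1 \<inter> sgn -` X)) = emeasure (distr lborel borel T) (ball 0 1 \<inter> sgn -` X)"
    using mb sb by (subst emeasure_distr) auto
  also have "\<dots> = emeasure lborel (ball 0 1 \<inter> sgn -` X)"
    by (simp add: lborel_distr_orthogonal[OF T])
  also have "\<dots> / emeasure lborel (ball 0 1 :: (real^'n) set) = emeasure sphere_measure X"
    by (simp only: emeasure_sphere_measure[OF X'] sphere_cone_eq[OF X'(2)])
  finally show "emeasure (distr sphere_measure sphere_measure T) X = emeasure sphere_measure X" .
qed

lemma integral_sphere_orthogonal:
  fixes T :: "real^'n \<Rightarrow> real^'n" and f :: "real^'n \<Rightarrow> 'b::{banach,second_countable_topology}"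
  assumes T: "orthogonal_transformation T" and f: "f \<in> borel_measurable sphere_measure"
  shows "(LINT w|sphere_measure. f (T w)) = (LINT w|sphere_measure. f w)"
proof -
  have "(LINT w|distr sphere_measure sphere_measure T. f w) = (LINT w|sphere_measure. f (T w))"
    by (rule integral_distr[OF measurable_sphere_orthogonal[OF T] f])
  then show ?thesis by (simp add: sphere_measure_distr_orthogonal[OF T])
qed

section \<open>Latitudes are null sets\<close>

text \<open>For \<open>0 \<le> s < 1\<close> the set lies in the frontier of the convex cone
  \<open>s * norm x \<le> x \<bullet> v\<close>, and frontiers of convex sets are negligible. For
  \<open>s \<ge> 1\<close> equality in Cauchy-Schwarz leaves at most the ray through
  \<open>v\<close>, which lies in a hyperplane. Negative \<open>s\<close> is reduced to this by
  replacing \<open>v\<close> with \<open>- v\<close>.\<close>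

lemma negligible_cone:
  fixes v :: "real^'n"
  assumes n: "CARD('n) \<ge> 2" and v: "norm v = 1"
  shows "negligible {x. x \<bullet> v = s * norm x}"
proof -
  have pos: "negligible {x. x \<bullet> v = s * norm x}" if v: "norm v = 1" and s: "0 \<le> s" for v :: "real^'n" and s
  proof (cases "s < 1")
    case True
    let ?C = "{x. s * norm x \<le> x \<bullet> v}"
    have "convex ?C"
    proof (rule convexI, clarsimp simp: inner_add_left)
      fix x y :: "real^'n" and p q :: real
      assume *: "s * norm x \<le> x \<bullet> v" "s * norm y \<le> y \<bullet> v" "0 \<le> p" "0 \<le> q" "p + q = 1"
      have "s * norm (p *\<^sub>R x + q *\<^sub>R y) \<le> s * (p * norm x + q * norm y)"
        using s *(3,4) norm_triangle_ineq[of "p *\<^sub>R x" "q *\<^sub>R y"] by (intro mult_left_mono) auto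
      also have "\<dots> \<le> p * (x \<bullet> v) + q * (y \<bullet> v)"
        using mult_left_mono[OF *(1) *(3)] mult_left_mono[OF *(2) *(4)] by (simp add: algebra_simps)
      finally show "s * norm (p *\<^sub>R x + q *\<^sub>R y) \<le> p * (x \<bullet> v) + q * (y \<bullet> v)" .
    qed
    then have "negligible (frontier ?C)" by (rule negligible_convex_frontier)
    moreover have "{x. x \<bullet> v = s * norm x} \<subseteq> frontier ?C"
    proof
      fix x assume "x \<in> {x. x \<bullet> v = s * norm x}"
      then have x: "x \<bullet> v = s * norm x" by simp
      have "x \<notin> interior ?C"
      proof
        assume "x \<in> interior ?C"
        \<comment> \<open>Moving from \<open>x\<close> against \<open>v\<close> by \<open>d\<close>
          lowers \<open>x \<bullet> v\<close> by \<open>d\<close> but \<open>s * norm x\<close> by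
          at most \<open>s * d\<close>, so the inequality defining the cone would fail at the new
          point.\<close>
        then obtain d where d: "d > 0" "cball x d \<subseteq> ?C" by (auto simp: mem_interior_cball)
        then have "x - d *\<^sub>R v \<in> ?C" using v by (auto simp: subset_iff dist_norm)
        then have "s * norm (x - d *\<^sub>R v) \<le> s * norm x - d"
          using v by (simp add: x inner_diff_left dot_square_norm)
        moreover have "s * (norm x - d) \<le> s * norm (x - d *\<^sub>R v)"
          using s v d norm_triangle_ineq2[of x "d *\<^sub>R v"] by (intro mult_left_mono) auto
        ultimately have "d * (1 - s) \<le> 0" by (simp add: algebra_simps)
        with True d show False by (simp add: mult_le_0_iff)
      qed
      then show "x \<in> frontier ?C" using x closure_subset[of ?C] by (auto simp: frontier_def)
    qed
    ultimately show ?thesis by (rule negligible_subset)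
  next
    case False
    \<comment> \<open>Dimension at least 2 enters here: a nonzero \<open>w\<close> orthogonal to
      \<open>v\<close> is the normal of a hyperplane that contains the ray.\<close>
    have "\<not> (\<forall>w::real^'n. w \<bullet> v = 0 \<longrightarrow> w = 0)"
    proof
      assume *: "\<forall>w::real^'n. w \<bullet> v = 0 \<longrightarrow> w = 0"
      have "dim {w. v \<bullet> w = 0} = CARD('n) - 1" using v by (subst dim_hyperplane) auto
      moreover have "{w. v \<bullet> w = 0} = {0}" using * by (auto simp: inner_commute)
      ultimately show False using n by simp
    qed
    then obtain w :: "real^'n" where w: "w \<bullet> v = 0" "w \<noteq> 0" by auto
    have "{x. x \<bullet> v = s * norm x} \<subseteq> {x. w \<bullet> x = 0}"
    proof clarify
      fix x assume x: "x \<bullet> v = s * norm x"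
      have "norm x * norm v \<le> s * norm x" using False v by (simp add: mult_right_mono mult_le_cancel_right1)
      with x have "x \<bullet> v = norm x * norm v" using norm_cauchy_schwarz[of x v] by simp
      then have "norm x *\<^sub>R v = norm v *\<^sub>R x" by (rule norm_cauchy_schwarz_eq[THEN iffD1])
      then have "x = norm x *\<^sub>R v" using v by simp
      then have "w \<bullet> x = norm x * (w \<bullet> v)" by (metis inner_scaleR_right)
      then show "w \<bullet> x = 0" using w by simp
    qed
    moreover have "negligible {x. w \<bullet> x = 0}" using w by (intro negligible_hyperplane) auto
    ultimately show ?thesis by (rule negligible_subset[rotated])
  qed
  show ?thesis
  proof (cases "0 \<le> s")
    case True then show ?thesis using pos v by simp
  next
    case False
    have "{x. x \<bullet> v = s * norm x} = {x. x \<bullet> (- v) = (- s) * norm x}" by auto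
    then show ?thesis using pos[of "-v" "-s"] v False by simp
  qed
qed

text \<open>The cone over a latitude is contained in the set of \<open>negligible_cone\<close>. This
  is what later makes the level sets of the Poisson kernel null.\<close>

lemma AE_sphere_inner_neq:
  fixes v :: "real^'n"
  assumes n: "CARD('n) \<ge> 2" and v: "norm v = 1"
  shows "AE w in sphere_measure. w \<bullet> v \<noteq> s"
proof (rule AE_I')
  let ?X = "{w \<in> sphere 0 1. w \<bullet> v = s}"
  have "closed ?X" 
  proof -
    have "?X = sphere 0 1 \<inter> {w. w \<bullet> v = s}" by auto
    then show ?thesis by (auto intro!: closed_Int closed_Collect_eq continuous_intros)
  qed
  then have X: "?X \<in> sets borel" "?X \<subseteq> sphere 0 1" by auto
  have "{t *\<^sub>R w |t w. 0 < t \<and> t < 1 \<and> w \<in> ?X} \<subseteq> {x. x \<bullet> v = s * norm x}" by auto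
  then have "negligible {t *\<^sub>R w |t w. 0 < t \<and> t < 1 \<and> w \<in> ?X}"
    using negligible_cone[OF n v] negligible_subset by blast
  then have "emeasure lborel {t *\<^sub>R w |t w. 0 < t \<and> t < 1 \<and> w \<in> ?X} = 0"
    using measurable_sets[OF borel_measurable_sgn X(1)]
    unfolding sphere_cone_eq[OF X(2)] negligible_iff_null_sets
    by (subst (asm) null_sets_completion_iff) (auto simp: null_setsD1)
  then have "emeasure sphere_measure ?X = 0" by (subst emeasure_sphere_measure[OF X]) simp
  moreover have "?X \<in> sets sphere_measure"
    using X by (auto simp: sets_sphere_measure sets_restrict_space)
  ultimately show "?X \<in> null_sets sphere_measure" by auto
  show "{w \<in> space sphere_measure. \<not> w \<bullet> v \<noteq> s} \<subseteq> ?X" by (auto simp: space_sphere_measure)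
qed

section \<open>Second differences and the maximum principle\<close>

definition second_diff :: "(real^'n \<Rightarrow> real) \<Rightarrow> real^'n \<Rightarrow> real \<Rightarrow> real" where
  "second_diff w x h = (\<Sum>i\<in>UNIV. w (x + h *\<^sub>R axis i 1) + w (x - h *\<^sub>R axis i 1) - 2 * w x) / h\<^sup>2"

text \<open>The limit presupposes no differentiability, is linear in \<open>w\<close>, and can be
  moved through a Poisson integral.\<close>

definition weakly_harmonic_at :: "(real^'n \<Rightarrow> real) \<Rightarrow> real^'n \<Rightarrow> bool" where
  "weakly_harmonic_at w x \<longleftrightarrow> (second_diff w x \<longlongrightarrow> 0) (at_right 0)"

lemma second_diff_diff:
  "second_diff (\<lambda>x. w x - v x) x h = second_diff w x h - second_diff v x h"
proof -
  have eq: "(\<Sum>i\<in>UNIV. w (x + h *\<^sub>R axis i 1) - v (x + h *\<^sub>R axis i 1)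
      + (w (x - h *\<^sub>R axis i 1) - v (x - h *\<^sub>R axis i 1)) - 2 * (w x - v x))
    = (\<Sum>i\<in>UNIV. (w (x + h *\<^sub>R axis i 1) + w (x - h *\<^sub>R axis i 1) - 2 * w x)
      - (v (x + h *\<^sub>R axis i 1) + v (x - h *\<^sub>R axis i 1) - 2 * v x))"
    by (intro sum.cong refl) (simp add: algebra_simps)
  show ?thesis unfolding second_diff_def eq by (simp only: sum_subtractf diff_divide_distrib)
qed

lemma weakly_harmonic_at_diff:
  "weakly_harmonic_at w x \<Longrightarrow> weakly_harmonic_at v x \<Longrightarrow> weakly_harmonic_at (\<lambda>x. w x - v x) x"
  unfolding weakly_harmonic_at_def second_diff_diff
  by (drule tendsto_diff, assumption) simp

lemma weakly_harmonic_at_const: "weakly_harmonic_at (\<lambda>_. c) x"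
  by (simp add: weakly_harmonic_at_def second_diff_def[abs_def])

lemma weakly_harmonic_at_cong:
  assumes "open S" "x \<in> S" "\<And>y. y \<in> S \<Longrightarrow> w y = v y"
  shows "weakly_harmonic_at w x \<longleftrightarrow> weakly_harmonic_at v x"
proof -
  obtain d where d: "d > 0" "ball x d \<subseteq> S" using assms openE by blast
  have "\<forall>\<^sub>F h in at_right 0. second_diff w x h = second_diff v x h"
    unfolding eventually_at_right_field
  proof (intro exI[of _ d] conjI d allI impI)
    fix h :: real assume h: "0 < h" "h < d"
    have "x + h *\<^sub>R axis i 1 \<in> S" "x - h *\<^sub>R axis i 1 \<in> S" for i
      using d(2) h by (auto simp: subset_iff dist_norm)
    then show "second_diff w x h = second_diff v x h"
      using assms by (simp add: second_diff_def)
  qed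
  then show ?thesis unfolding weakly_harmonic_at_def by (rule tendsto_cong)
qed

text \<open>Adding \<open>e * (norm y)^2\<close> raises each axis term of the second difference by
  exactly \<open>2 * e * h^2\<close>. At an interior maximum of the perturbed function the second
  differences of \<open>w\<close> are therefore bounded by a negative constant, against their limit
  0.\<close>

lemma weakly_harmonic_max_principle:
  fixes w :: "real^'n \<Rightarrow> real"
  assumes cont: "continuous_on (cball 0 1) w"
    and harm: "\<And>x. x \<in> ball 0 1 \<Longrightarrow> weakly_harmonic_at w x"
    and bd: "\<And>x. x \<in> sphere 0 1 \<Longrightarrow> w x \<le> 0"
    and x: "x \<in> cball 0 1"
  shows "w x \<le> 0"
proof (rule ccontr)
  assume "\<not> w x \<le> 0"
  \<comment> \<open>On the sphere the perturbed function is at most \<open>e\<close>, while at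
    \<open>x\<close> it is at least \<open>w x = 2 * e\<close>; hence its maximum is attained
    inside.\<close>
  define e where "e = w x / 2"
  have e: "e > 0" using \<open>\<not> w x \<le> 0\<close> by (simp add: e_def)
  let ?W = "\<lambda>y. w y + e * (norm y)\<^sup>2"
  have "continuous_on (cball 0 1) ?W" by (intro continuous_intros cont)
  then obtain z where z: "z \<in> cball 0 1" "\<And>y. y \<in> cball 0 1 \<Longrightarrow> ?W y \<le> ?W z"
    using continuous_attains_sup[of "cball 0 1 :: (real^'n) set" ?W] by auto
  have "w x \<le> ?W x" using e by simp
  also have "\<dots> \<le> ?W z" using z x by blast
  finally have wz: "w x \<le> ?W z" .
  have "norm z \<noteq> 1"
  proof
    assume "norm z = 1"
    then have "w z \<le> 0" using bd by simp
    then show False using wz \<open>norm z = 1\<close> e by (simp add: e_def)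
  qed
  then have zb: "norm z < 1" using z by simp
  have "\<forall>\<^sub>F h in at_right 0. second_diff w z h \<le> - (2 * e)"
    unfolding eventually_at_right_field
  proof (intro exI[of _ "1 - norm z"] conjI allI impI)
    fix h :: real assume h: "0 < h" "h < 1 - norm z"
    have "w (z + h *\<^sub>R axis i 1) + w (z - h *\<^sub>R axis i 1) - 2 * w z \<le> - (2 * e) * h\<^sup>2" for i
    proof -
      have "norm (z + h *\<^sub>R axis i 1) \<le> 1" "norm (z - h *\<^sub>R axis i 1) \<le> 1"
        using norm_triangle_ineq[of z "h *\<^sub>R axis i 1"] norm_triangle_ineq4[of z "h *\<^sub>R axis i 1"] h by auto
      then have "?W (z + h *\<^sub>R axis i 1) \<le> ?W z" "?W (z - h *\<^sub>R axis i 1) \<le> ?W z"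
        using z(2) by auto
      moreover have "(norm (z + h *\<^sub>R axis i 1))\<^sup>2 + (norm (z - h *\<^sub>R axis i 1))\<^sup>2 = 2 * (norm z)\<^sup>2 + 2 * h\<^sup>2"
        unfolding power2_norm_eq_inner
        by (simp add: inner_add_left inner_add_right inner_diff_left inner_diff_right
            inner_axis_axis power2_eq_square inner_commute)
      then have "e * (norm (z + h *\<^sub>R axis i 1))\<^sup>2 + e * (norm (z - h *\<^sub>R axis i 1))\<^sup>2 = 2 * e * (norm z)\<^sup>2 + 2 * e * h\<^sup>2"
        by (subst distrib_left[symmetric]) (simp add: distrib_left)
      ultimately show ?thesis by simp
    qed
    then have "(\<Sum>i\<in>UNIV. w (z + h *\<^sub>R axis i 1) + w (z - h *\<^sub>R axis i 1) - 2 * w z) \<le> (\<Sum>i\<in>(UNIV::'n set). - (2 * e) * h\<^sup>2)"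
      by (intro sum_mono) 
    also have "\<dots> = real CARD('n) * (- (2 * e) * h\<^sup>2)" by simp
    \<comment> \<open>One axis already gives a negative bound, so the dimension factor is
      dropped.\<close>
    also have "\<dots> \<le> 1 * (- (2 * e) * h\<^sup>2)"
    proof (rule mult_right_mono_neg)
      have "0 < CARD('n)" by simp
      then show "1 \<le> real CARD('n)" by linarith
    qed (use e in simp)
    finally show "second_diff w z h \<le> - (2 * e)"
      using h by (simp add: second_diff_def divide_le_eq)
  qed (use zb in simp)
  moreover have "(second_diff w z \<longlongrightarrow> 0) (at_right 0)"
    using harm[of z] zb by (simp add: weakly_harmonic_at_def)
  ultimately have "0 \<le> - (2 * e)" by (intro tendsto_upperbound) auto
  then show False using e by simp
qed

lemma weakly_harmonic_eqI:
  fixes w v :: "real^'n \<Rightarrow> real"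
  assumes "continuous_on (cball 0 1) w" "continuous_on (cball 0 1) v"
    and "\<And>x. x \<in> ball 0 1 \<Longrightarrow> weakly_harmonic_at w x"
    and "\<And>x. x \<in> ball 0 1 \<Longrightarrow> weakly_harmonic_at v x"
    and "\<And>x. x \<in> sphere 0 1 \<Longrightarrow> w x = v x"
    and "x \<in> cball 0 1"
  shows "w x = v x"
proof -
  have "w x - v x \<le> 0" 
    by (rule weakly_harmonic_max_principle[of "\<lambda>x. w x - v x"])
      (use assms in \<open>auto intro!: continuous_intros weakly_harmonic_at_diff\<close>)
  moreover have "v x - w x \<le> 0" 
    by (rule weakly_harmonic_max_principle[of "\<lambda>x. v x - w x"])
      (use assms in \<open>auto intro!: continuous_intros weakly_harmonic_at_diff\<close>)
  ultimately show ?thesis by simp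
qed

section \<open>From classical to weak harmonicity\<close>

text \<open>Taylor's formula with Lagrange remainder for the even function
  \<open>g t + g (-t)\<close>: its first derivative vanishes at 0, and one intermediate point
  \<open>s\<close> serves both signs.\<close>

lemma symmetric_second_difference:
  fixes g g' g'' :: "real \<Rightarrow> real"
  assumes h: "0 < h"
    and g: "\<And>t. \<bar>t\<bar> \<le> h \<Longrightarrow> (g has_real_derivative g' t) (at t)"
    and g': "\<And>t. \<bar>t\<bar> \<le> h \<Longrightarrow> (g' has_real_derivative g'' t) (at t)"
  obtains s where "0 < s" "s < h" "g h + g (-h) - 2 * g 0 = h\<^sup>2 * ((g'' s + g'' (-s)) / 2)"
proof -
  define d where "d m = (if m = 0 then (\<lambda>t. g t + g (-t)) else
    if m = 1 then (\<lambda>t. g' t - g' (-t)) else (\<lambda>t. g'' t + g'' (-t)))" for m :: nat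
  have "\<exists>t>0. t < h \<and> d 0 h = (\<Sum>m<2. d m 0 / fact m * h ^ m) + d 2 t / fact 2 * h ^ 2"
  proof (rule Maclaurin[OF h])
    show "\<forall>m t. m < 2 \<and> 0 \<le> t \<and> t \<le> h \<longrightarrow> (d m has_real_derivative d (Suc m) t) (at t)"
    proof (intro allI impI)
      fix m :: nat and t assume mt: "m < 2 \<and> 0 \<le> t \<and> t \<le> h"
      have 1: "((\<lambda>t. g (- t)) has_real_derivative - g' (- t)) (at t)"
        using g[of "-t"] mt by (simp add: DERIV_mirror)
      have 2: "((\<lambda>t. g' (- t)) has_real_derivative - g'' (- t)) (at t)"
        using g'[of "-t"] mt by (simp add: DERIV_mirror)
      have "m = 0 \<or> m = 1" using mt by auto
      then show "(d m has_real_derivative d (Suc m) t) (at t)"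
        using DERIV_add[OF g 1] DERIV_diff[OF g' 2] mt by (auto simp: d_def)
    qed
  qed auto
  then obtain t where t: "0 < t" "t < h" "d 0 h = (\<Sum>m<2. d m 0 / fact m * h ^ m) + d 2 t / fact 2 * h ^ 2"
    by auto
  show thesis
  proof (rule that[OF t(1,2)])
    show "g h + g (-h) - 2 * g 0 = h\<^sup>2 * ((g'' t + g'' (-t)) / 2)"
      using t(3) by (simp add: d_def numeral_2_eq_2 field_simps)
  qed
qed

lemma second_difference_tendsto:
  fixes g g' g'' :: "real \<Rightarrow> real"
  assumes e: "0 < e"
    and g: "\<And>t. \<bar>t\<bar> < e \<Longrightarrow> (g has_real_derivative g' t) (at t)"
    and g': "\<And>t. \<bar>t\<bar> < e \<Longrightarrow> (g' has_real_derivative g'' t) (at t)"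
    and g'': "isCont g'' 0"
  shows "((\<lambda>h. (g h + g (-h) - 2 * g 0) / h\<^sup>2) \<longlongrightarrow> g'' 0) (at_right 0)"
proof (rule tendstoI)
  fix \<epsilon> :: real assume "\<epsilon> > 0"
  then obtain d where d: "d > 0" "\<And>t. \<bar>t\<bar> < d \<Longrightarrow> \<bar>g'' t - g'' 0\<bar> < \<epsilon>"
    using g'' unfolding continuous_at_eps_delta dist_real_def by auto
  show "\<forall>\<^sub>F h in at_right 0. dist ((g h + g (-h) - 2 * g 0) / h\<^sup>2) (g'' 0) < \<epsilon>"
    unfolding eventually_at_right_field
  proof (intro exI[of _ "min d e"] conjI allI impI)
    fix h assume h: "0 < h" "h < min d e"
    obtain s where s: "0 < s" "s < h" "g h + g (-h) - 2 * g 0 = h\<^sup>2 * ((g'' s + g'' (-s)) / 2)"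
      by (rule symmetric_second_difference[OF h(1), of g g' g'']) (use g g' h in auto)
    have eq: "(g h + g (-h) - 2 * g 0) / h\<^sup>2 = (g'' s + g'' (-s)) / 2"
      unfolding s(3) using h by simp
    have "\<bar>g'' s - g'' 0\<bar> < \<epsilon>" "\<bar>g'' (-s) - g'' 0\<bar> < \<epsilon>"
      using d(2) s h by auto
    then show "dist ((g h + g (-h) - 2 * g 0) / h\<^sup>2) (g'' 0) < \<epsilon>"
      unfolding eq dist_real_def by (simp add: field_simps abs_less_iff)
  qed (use d e in auto)
qed

text \<open>The line is traversed with speed \<open>c\<close>, so that dilations of \<open>f\<close>
  are handled by the chain rule in one real variable.\<close>

lemma partial_deriv_line:
  assumes U: "open U" and f: "f differentiable_on U" and x: "x + (c * t) *\<^sub>R axis i 1 \<in> U"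
  shows "((\<lambda>t. f (x + (c * t) *\<^sub>R axis i 1)) has_real_derivative
    c * partial_deriv i f (x + (c * t) *\<^sub>R axis i 1)) (at t)"
proof -
  let ?y = "x + (c * t) *\<^sub>R axis i 1"
  have "(f has_derivative frechet_derivative f (at ?y)) (at ?y)"
    using f U x by (metis at_within_open differentiable_on_def frechet_derivative_works)
  moreover have "((\<lambda>t. x + (c * t) *\<^sub>R axis i 1) has_derivative (\<lambda>s. (c * s) *\<^sub>R axis i 1)) (at t)"
    by (auto intro!: derivative_eq_intros)
  ultimately have "((\<lambda>t. f (x + (c * t) *\<^sub>R axis i 1)) has_derivative
      (\<lambda>s. frechet_derivative f (at ?y) ((c * s) *\<^sub>R axis i 1))) (at t)"
    by (rule has_derivative_compose[rotated])
  moreover have "linear (frechet_derivative f (at ?y))"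
    using \<open>(f has_derivative frechet_derivative f (at ?y)) (at ?y)\<close> has_derivative_linear by blast
  then have "frechet_derivative f (at ?y) ((c * s) *\<^sub>R axis i 1) = s * (c * partial_deriv i f ?y)" for s
    by (simp add: linear_cmul partial_deriv_def)
  then have "(\<lambda>s. frechet_derivative f (at ?y) ((c * s) *\<^sub>R axis i 1)) = (*) (c * partial_deriv i f ?y)"
    by (auto simp: fun_eq_iff)
  ultimately show ?thesis by (simp only: has_field_derivative_def)
qed

text \<open>Each axis contributes \<open>c^2\<close> times a pure second derivative at the dilated
  point, so the limit is \<open>c^2\<close> times the Laplacian there. The dilation is built in
  because a dilation of \<open>F\<close> by a factor below 1 is continuous up to the sphere.\<close>

lemma weakly_harmonic_scaled:
  fixes f :: "real^'n \<Rightarrow> real"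
  assumes U: "open U" and C2: "C2_on U f" and lap: "\<And>x. x \<in> U \<Longrightarrow> laplacian f x = 0"
    and x: "c *\<^sub>R x \<in> U"
  shows "weakly_harmonic_at (\<lambda>y. f (c *\<^sub>R y)) x"
proof -
  have d1: "f differentiable_on U" and d2: "\<And>i. partial_deriv i f differentiable_on U"
    and ct: "\<And>i j. continuous_on U (partial_deriv j (partial_deriv i f))"
    using C2 by (auto simp: C2_on_def)
  have cl: "continuous_on UNIV (\<lambda>t. c *\<^sub>R x + (c * t) *\<^sub>R axis i 1)" for i
    by (intro continuous_intros)
  have lim: "((\<lambda>h. (f (c *\<^sub>R x + (c * h) *\<^sub>R axis i 1) + f (c *\<^sub>R x + (c * (- h)) *\<^sub>R axis i 1)
      - 2 * f (c *\<^sub>R x + (c * 0) *\<^sub>R axis i 1)) / h\<^sup>2)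
      \<longlongrightarrow> c * (c * partial_deriv i (partial_deriv i f) (c *\<^sub>R x + (c * 0) *\<^sub>R axis i 1))) (at_right 0)" for i
  proof -
    let ?l = "\<lambda>t. c *\<^sub>R x + (c * t) *\<^sub>R axis i 1"
    have "open (?l -` U)" using U cl by (simp add: open_vimage)
    moreover have "0 \<in> ?l -` U" using x by simp
    ultimately obtain e where e: "e > 0" "ball 0 e \<subseteq> ?l -` U" using openE by blast
    then have inU: "?l t \<in> U" if "\<bar>t\<bar> < e" for t using that by (auto simp: subset_iff dist_norm)
    show ?thesis
    proof (rule second_difference_tendsto[OF e(1), of _ "\<lambda>t. c * partial_deriv i f (?l t)"])
      fix t :: real assume t: "\<bar>t\<bar> < e"
      show "((\<lambda>t. f (?l t)) has_real_derivative c * partial_deriv i f (?l t)) (at t)"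
        using inU[OF t] by (rule partial_deriv_line[OF U d1])
      show "((\<lambda>t. c * partial_deriv i f (?l t)) has_real_derivative
          c * (c * partial_deriv i (partial_deriv i f) (?l t))) (at t)"
        by (intro DERIV_cmult partial_deriv_line[OF U d2] inU t)
    next
      have "isCont (partial_deriv i (partial_deriv i f)) (?l 0)"
        using ct U x by (simp add: continuous_on_eq_continuous_at)
      then have "isCont (\<lambda>t. partial_deriv i (partial_deriv i f) (?l t)) 0"
        by (rule isCont_o2[of 0 ?l, rotated]) (intro continuous_intros)
      then show "isCont (\<lambda>t. c * (c * partial_deriv i (partial_deriv i f) (?l t))) 0"
        by (rule isCont_mult[OF continuous_const isCont_mult[OF continuous_const]])
    qed
  qed
  have "((\<lambda>h. \<Sum>i\<in>UNIV. (f (c *\<^sub>R x + (c * h) *\<^sub>R axis i 1) + f (c *\<^sub>R x + (c * (- h)) *\<^sub>R axis i 1)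
      - 2 * f (c *\<^sub>R x + (c * 0) *\<^sub>R axis i 1)) / h\<^sup>2)
      \<longlongrightarrow> (\<Sum>i\<in>UNIV. c * (c * partial_deriv i (partial_deriv i f) (c *\<^sub>R x + (c * 0) *\<^sub>R axis i 1)))) (at_right 0)"
    by (intro tendsto_sum lim)
  also have "(\<Sum>i\<in>UNIV. c * (c * partial_deriv i (partial_deriv i f) (c *\<^sub>R x + (c * 0) *\<^sub>R axis i 1))) = 0"
    using lap[OF x] by (simp add: laplacian_def sum_distrib_left[symmetric])
  finally show ?thesis
    unfolding weakly_harmonic_at_def second_diff_def[abs_def]
    by (simp add: sum_divide_distrib scaleR_add_right scaleR_diff_right)
qed

section \<open>The Poisson kernel\<close>

definition poisson_kernel :: "real^'n \<Rightarrow> real^'n \<Rightarrow> real" where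
  "poisson_kernel x w = (1 - (norm x)\<^sup>2) / norm (x - w) ^ CARD('n)"

lemma poisson_eq: "poisson f x = (LINT w|sphere_measure. poisson_kernel x w *\<^sub>R f w)"
  by (simp add: poisson_def poisson_kernel_def)

lemma poisson_kernel_0: "norm w = 1 \<Longrightarrow> poisson_kernel 0 w = 1"
  by (simp add: poisson_kernel_def)

lemma poisson_kernel_pos: "norm x < 1 \<Longrightarrow> norm w = 1 \<Longrightarrow> 0 < poisson_kernel x w"
  unfolding poisson_kernel_def
  by (intro divide_pos_pos zero_less_power) (auto simp: abs_square_less_1)

text \<open>The kernel decreases as the distance from \<open>x\<close> to \<open>w\<close> grows.
  With \<open>d = 1 - norm x\<close> this bounds it uniformly in \<open>w\<close>; with
  \<open>d\<close> fixed it shows that the kernel is small far from \<open>x\<close> when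
  \<open>x\<close> approaches the sphere.\<close>

lemma poisson_kernel_le:
  fixes x w :: "real^'n"
  assumes "norm x \<le> 1" "0 < d" "d \<le> norm (x - w)"
  shows "poisson_kernel x w \<le> (1 - (norm x)\<^sup>2) / d ^ CARD('n)"
proof -
  have "0 < norm (x - w)" using assms by linarith
  then show ?thesis unfolding poisson_kernel_def using assms
    by (intro divide_left_mono power_mono mult_pos_pos zero_less_power) (auto simp: power_le_one)
qed

lemma poisson_kernel_bound:
  fixes x w :: "real^'n"
  assumes "norm x < 1" "norm w = 1"
  shows "\<bar>poisson_kernel x w\<bar> \<le> 1 / (1 - norm x) ^ CARD('n)"
proof -
  have "1 - norm x \<le> norm (x - w)" using norm_triangle_ineq2[of w x] assms by (simp add: norm_minus_commute)
  then have "poisson_kernel x w \<le> (1 - (norm x)\<^sup>2) / (1 - norm x) ^ CARD('n)"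
    using assms by (intro poisson_kernel_le) auto
  also have "\<dots> \<le> 1 / (1 - norm x) ^ CARD('n)"
    using assms by (intro divide_right_mono) auto
  finally show ?thesis using poisson_kernel_pos[OF assms] by simp
qed

lemma poisson_kernel_orthogonal:
  fixes T :: "real^'n \<Rightarrow> real^'n"
  assumes "orthogonal_transformation T"
  shows "poisson_kernel (T x) (T w) = poisson_kernel x w"
proof -
  have "linear T" and n: "\<And>x. norm (T x) = norm x"
    using assms by (auto simp: orthogonal_transformation)
  then have "norm (T x - T w) = norm (x - w)" by (simp add: linear_diff[symmetric])
  with n show ?thesis by (simp add: poisson_kernel_def)
qed

lemma borel_measurable_sphereI:
  "f \<in> borel_measurable borel \<Longrightarrow> f \<in> borel_measurable sphere_measure"
  by (simp add: borel_measurable_sphere_measure measurable_restrict_space1)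

lemma poisson_kernel_measurable [measurable]:
  "(\<lambda>w. poisson_kernel x w) \<in> borel_measurable sphere_measure"
  unfolding poisson_kernel_def by (intro borel_measurable_sphereI) measurable

lemma integrable_poisson:
  fixes f :: "real^'n \<Rightarrow> 'b::{banach,second_countable_topology}"
  assumes f [measurable]: "f \<in> borel_measurable sphere_measure"
    and B: "AE w in sphere_measure. norm (f w) \<le> B" and x: "norm x < 1"
  shows "integrable sphere_measure (\<lambda>w. poisson_kernel x w *\<^sub>R f w)"
proof (rule sphere.integrable_const_bound)
  show "AE w in sphere_measure. norm (poisson_kernel x w *\<^sub>R f w) \<le> 1 / (1 - norm x) ^ CARD('n) * B"
    using B AE_sphere_norm
  proof eventually_elim
    case (elim w)
    show ?case
      unfolding norm_scaleR using elim x
      by (intro mult_mono poisson_kernel_bound) auto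
  qed
qed measurable

section \<open>Harmonicity of the Poisson kernel and of Poisson integrals\<close>

text \<open>Along a coordinate line the kernel is \<open>s * q powr \<alpha>\<close> with quadratic
  polynomials \<open>s\<close> and \<open>q\<close>. Since \<open>s'' = -2\<close> and
  \<open>q'' = 2\<close>, the product rule gives \<open>k1\<close> and \<open>k2\<close>; the real
  exponent treats odd and even dimensions alike.\<close>

lemma poisson_kernel_line_derivs:
  fixes x w :: "real^'n" and i :: 'n
  defines "\<alpha> \<equiv> - real CARD('n) / 2"
  defines "q \<equiv> \<lambda>t. (norm (x + t *\<^sub>R axis i 1 - w))\<^sup>2"
    and "s \<equiv> \<lambda>t. 1 - (norm (x + t *\<^sub>R axis i 1))\<^sup>2"
    and "q' \<equiv> \<lambda>t. 2 * ((x - w) $ i + t)" and "s' \<equiv> \<lambda>t. - 2 * (x $ i + t)"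
  defines "k1 \<equiv> \<lambda>t. s' t * q t powr \<alpha> + \<alpha> * s t * q' t * q t powr (\<alpha> - 1)"
    and "k2 \<equiv> \<lambda>t. - 2 * q t powr \<alpha> + 2 * \<alpha> * s' t * q' t * q t powr (\<alpha> - 1)
        + \<alpha> * (\<alpha> - 1) * s t * (q' t)\<^sup>2 * q t powr (\<alpha> - 2) + 2 * \<alpha> * s t * q t powr (\<alpha> - 1)"
  assumes t: "x + t *\<^sub>R axis i 1 \<noteq> w"
  shows "((\<lambda>t. poisson_kernel (x + t *\<^sub>R axis i 1) w) has_real_derivative k1 t) (at t)"
    and "(k1 has_real_derivative k2 t) (at t)"
proof -
  have q: "q t = (norm (x - w))\<^sup>2 + 2 * t * (x - w) $ i + t\<^sup>2" for t
    unfolding q_def power2_norm_eq_inner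
    by (simp add: inner_add_left inner_add_right inner_diff_left inner_diff_right
        inner_axis_axis inner_axis inner_axis' inner_commute power2_eq_square algebra_simps)
  have s: "s t = 1 - (norm x)\<^sup>2 - 2 * t * x $ i - t\<^sup>2" for t
    unfolding s_def power2_norm_eq_inner
    by (simp add: inner_add_left inner_add_right
        inner_axis_axis inner_axis inner_axis' inner_commute power2_eq_square algebra_simps)
  have dq: "(q has_real_derivative q' t) (at t)" for t
    unfolding q[abs_def] q'_def by (auto intro!: derivative_eq_intros simp: algebra_simps)
  have ds: "(s has_real_derivative s' t) (at t)" for t
    unfolding s[abs_def] s'_def by (auto intro!: derivative_eq_intros simp: algebra_simps)
  have dq': "(q' has_real_derivative 2) (at t)" for t
    unfolding q'_def by (auto intro!: derivative_eq_intros)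
  have ds': "(s' has_real_derivative - 2) (at t)" for t
    unfolding s'_def by (auto intro!: derivative_eq_intros)
  have qpos: "0 < q t" using t by (simp add: q_def)
  \<comment> \<open>This holds even at the pole, where division by zero and
    \<open>0 powr \<alpha>\<close> both give 0; being valid for all \<open>t\<close>, it can rewrite
    the function under the derivative.\<close>
  have pk: "poisson_kernel (x + t *\<^sub>R axis i 1) w = s t * q t powr \<alpha>" for t
  proof (cases "x + t *\<^sub>R axis i 1 = w")
    case False
    define c where "c = norm (x + t *\<^sub>R axis i 1 - w)"
    have c: "c > 0" using False by (simp add: c_def)
    have "q t = c powr 2" using c by (simp add: q_def c_def powr_numeral)
    then have "q t powr \<alpha> = c powr (2 * \<alpha>)" by (simp only: powr_powr)
    also have "\<dots> = inverse (c ^ CARD('n))"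
      using c by (simp add: \<alpha>_def powr_minus powr_realpow)
    finally show ?thesis by (simp add: poisson_kernel_def s_def c_def divide_inverse)
  qed (simp add: poisson_kernel_def q_def)
  have dp: "((\<lambda>t. q t powr \<beta>) has_real_derivative \<beta> * q t powr (\<beta> - 1) * q' t) (at t)" for \<beta>
    by (rule DERIV_chain2[OF has_real_derivative_powr[OF qpos] dq])
  show "((\<lambda>t. poisson_kernel (x + t *\<^sub>R axis i 1) w) has_real_derivative k1 t) (at t)"
    unfolding pk k1_def
    by (rule DERIV_cong[OF DERIV_mult[OF ds dp]]) (simp add: algebra_simps)
  show "(k1 has_real_derivative k2 t) (at t)"
    unfolding k1_def
    by (rule DERIV_cong[OF DERIV_add[OF DERIV_mult[OF ds' dp]
        DERIV_mult[OF DERIV_mult[OF DERIV_cmult[OF ds] dq'] dp]]])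
      (simp add: k2_def algebra_simps power2_eq_square)
qed

text \<open>A pointwise limit and a bound uniform in \<open>w\<close>: the two inputs of dominated
  convergence for Poisson integrals.\<close>

lemma second_diff_poisson_kernel:
  fixes x w :: "real^'n"
  assumes x: "norm x < 1"
  shows "norm w = 1 \<Longrightarrow> ((\<lambda>h. second_diff (\<lambda>y. poisson_kernel y w) x h) \<longlongrightarrow> 0) (at_right 0)"
    and "\<exists>C. \<forall>w. norm w = 1 \<longrightarrow> (\<forall>h. 0 < h \<and> h < (1 - norm x) / 2 \<longrightarrow>
      \<bar>second_diff (\<lambda>y. poisson_kernel y w) x h\<bar> \<le> C)"
proof -
  define \<alpha> where "\<alpha> = - real CARD('n) / 2"
  define q where "q i w t = (norm (x + t *\<^sub>R axis i 1 - w))\<^sup>2" for i t and w :: "real^'n"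
  define s where "s i t = 1 - (norm (x + t *\<^sub>R axis i 1))\<^sup>2" for i t
  define q' where "q' i w t = 2 * ((x - w) $ i + t)" for i t and w :: "real^'n"
  define s' where "s' i t = - 2 * (x $ i + t)" for i t
  define k1 where "k1 i w t = s' i t * q i w t powr \<alpha> + \<alpha> * s i t * q' i w t * q i w t powr (\<alpha> - 1)" for i w t
  define k2 where "k2 i w t = - 2 * q i w t powr \<alpha> + 2 * \<alpha> * s' i t * q' i w t * q i w t powr (\<alpha> - 1)
        + \<alpha> * (\<alpha> - 1) * s i t * (q' i w t)\<^sup>2 * q i w t powr (\<alpha> - 2) + 2 * \<alpha> * s i t * q i w t powr (\<alpha> - 1)" for i w t
  \<comment> \<open>Half the distance to the sphere: all coordinate segments of this half-length
    around \<open>x\<close> keep a positive distance from the sphere.\<close>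
  define \<delta> where "\<delta> = (1 - norm x) / 2"
  have \<delta>: "0 < \<delta>" "norm x + \<delta> < 1" using x by (auto simp: \<delta>_def field_simps)
  have ne: "x + t *\<^sub>R axis i 1 \<noteq> w" if "norm w = 1" "\<bar>t\<bar> \<le> \<delta>" for w t i
    using norm_triangle_ineq[of x "t *\<^sub>R axis i 1"] that \<delta> by auto
  have d1: "((\<lambda>t. poisson_kernel (x + t *\<^sub>R axis i 1) w) has_real_derivative k1 i w t) (at t)"
    and d2: "(k1 i w has_real_derivative k2 i w t) (at t)"
    if "norm w = 1" "\<bar>t\<bar> \<le> \<delta>" for w t i
    using poisson_kernel_line_derivs[OF ne[OF that]]
    unfolding k1_def[abs_def] k2_def q_def s_def q'_def s'_def \<alpha>_def by auto
  \<comment> \<open>Continuity is joint in \<open>w\<close> and \<open>t\<close>, since compactness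
    of the product is what yields a bound independent of \<open>w\<close>.\<close>
  have cont: "continuous_on (sphere 0 1 \<times> {-\<delta>..\<delta>}) (\<lambda>(w, t). k2 i w t)" for i
  proof -
    let ?D = "sphere 0 1 \<times> {-\<delta>..\<delta>} :: ((real^'n) \<times> real) set"
    have "q i w t \<noteq> 0" if "norm w = 1" "\<bar>t\<bar> \<le> \<delta>" for w t
      using ne[OF that, of i] by (simp add: q_def)
    then have q0: "\<forall>p\<in>?D. q i (fst p) (snd p) \<noteq> 0" by (auto simp: abs_le_iff)
    have cq: "continuous_on ?D (\<lambda>p. q i (fst p) (snd p))"
      and cs: "continuous_on ?D (\<lambda>p. s i (snd p))"
      and cq': "continuous_on ?D (\<lambda>p. q' i (fst p) (snd p))"
      and cs': "continuous_on ?D (\<lambda>p. s' i (snd p))"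
      unfolding q_def s_def q'_def s'_def by (intro continuous_intros)+
    note cp = continuous_on_powr[OF cq continuous_on_const q0]
    show ?thesis
      unfolding k2_def case_prod_beta
      by (intro continuous_on_add continuous_on_mult continuous_on_power continuous_on_const
          cs cq' cs' cp)
  qed
  have lim: "((\<lambda>h. (poisson_kernel (x + h *\<^sub>R axis i 1) w + poisson_kernel (x + (- h) *\<^sub>R axis i 1) w
      - 2 * poisson_kernel (x + 0 *\<^sub>R axis i 1) w) / h\<^sup>2) \<longlongrightarrow> k2 i w 0) (at_right 0)"
    if w: "norm w = 1" for w i
  proof (rule second_difference_tendsto[OF \<delta>(1), of _ "k1 i w" "k2 i w"])
    have "continuous_on {-\<delta>..\<delta>} (\<lambda>t. (\<lambda>(w, t). k2 i w t) (w, t))"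
      by (rule continuous_on_compose2[OF cont]) (use w in \<open>auto intro!: continuous_intros\<close>)
    then have "continuous_on {-\<delta><..<\<delta>} (k2 i w)"
      by (auto intro: continuous_on_subset)
    then show "isCont (k2 i w) 0"
      using \<delta> by (simp add: continuous_on_eq_continuous_at)
  qed (use w in \<open>auto intro!: d1 d2\<close>)
  have sum0: "(\<Sum>i\<in>UNIV. k2 i w 0) = 0" if w: "norm w = 1" for w
  proof -
    define A where "A = (norm (x - w))\<^sup>2"
    define s0 where "s0 = 1 - (norm x)\<^sup>2"
    \<comment> \<open>The lowest power that occurs; the others are \<open>A * c\<close> and
      \<open>A^2 * c\<close>, which leaves a polynomial identity.\<close>
    define c where "c = A powr (\<alpha> - 2)"
    have A: "A > 0" using ne[of w 0] w \<delta> by (auto simp: A_def)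
    have p1: "A powr (\<alpha> - 1) = A * c" and p0: "A powr \<alpha> = A\<^sup>2 * c"
      using A powr_add[of A "\<alpha> - 2" 1] powr_add[of A "\<alpha> - 2" 2]
      by (simp_all add: c_def powr_numeral)
    have qs: "q i w 0 = A" "s i 0 = s0" "s' i 0 = - 2 * x $ i" "q' i w 0 = 2 * (x - w) $ i" for i
      by (simp_all add: q_def s_def s'_def q'_def A_def s0_def)
    have "(\<Sum>i\<in>UNIV. k2 i w 0) = (\<Sum>i\<in>UNIV. - 2 * A\<^sup>2 * c - 8 * \<alpha> * A * c * (x $ i * (x - w) $ i)
        + 4 * \<alpha> * (\<alpha> - 1) * s0 * c * ((x - w) $ i * (x - w) $ i) + 2 * \<alpha> * s0 * A * c)"
      unfolding k2_def qs p0 p1 c_def[symmetric]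
      by (intro sum.cong refl) (simp add: power2_eq_square algebra_simps)
    also have "\<dots> = real CARD('n) * (- 2 * A\<^sup>2 * c) - 8 * \<alpha> * A * c * (x \<bullet> (x - w))
        + 4 * \<alpha> * (\<alpha> - 1) * s0 * c * ((x - w) \<bullet> (x - w)) + real CARD('n) * (2 * \<alpha> * s0 * A * c)"
      by (simp add: sum.distrib sum_subtractf inner_vec_def sum_distrib_left)
    also have "(x - w) \<bullet> (x - w) = A" by (simp add: A_def power2_norm_eq_inner)
    \<comment> \<open>Here \<open>norm w = 1\<close> enters. With \<open>n\<close> for the
      dimension, the whole sum becomes
      \<open>A * c * (n + 2 * \<alpha>) * (2 * \<alpha> * s0 - 2 * A)\<close>, which vanishes for
      \<open>\<alpha> = - n / 2\<close>.\<close>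
    also have "x \<bullet> (x - w) = (A - s0) / 2"
      using w by (simp add: A_def s0_def power2_norm_eq_inner norm_eq_1 inner_diff_left inner_diff_right inner_commute)
    also have "real CARD('n) = - 2 * \<alpha>" by (simp add: \<alpha>_def)
    finally show ?thesis by (simp add: field_simps power2_eq_square)
  qed
  show "((\<lambda>h. second_diff (\<lambda>y. poisson_kernel y w) x h) \<longlongrightarrow> 0) (at_right 0)" if w: "norm w = 1"
  proof -
    have "((\<lambda>h. \<Sum>i\<in>UNIV. (poisson_kernel (x + h *\<^sub>R axis i 1) w + poisson_kernel (x + (- h) *\<^sub>R axis i 1) w
      - 2 * poisson_kernel (x + 0 *\<^sub>R axis i 1) w) / h\<^sup>2) \<longlongrightarrow> (\<Sum>i\<in>UNIV. k2 i w 0)) (at_right 0)"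
      by (intro tendsto_sum lim w)
    then show ?thesis by (simp add: second_diff_def sum_divide_distrib sum0[OF w])
  qed
  have "\<exists>C. \<forall>w t. norm w = 1 \<longrightarrow> \<bar>t\<bar> \<le> \<delta> \<longrightarrow> \<bar>k2 i w t\<bar> \<le> C" for i
  proof -
    have "compact ((\<lambda>(w, t). k2 i w t) ` (sphere 0 1 \<times> {-\<delta>..\<delta>}))"
      by (intro compact_continuous_image cont compact_Times compact_sphere compact_Icc)
    then obtain C where "\<forall>y\<in>(\<lambda>(w, t). k2 i w t) ` (sphere 0 1 \<times> {-\<delta>..\<delta>}). norm y \<le> C"
      using compact_imp_bounded bounded_iff by metis
    then show ?thesis by (intro exI[of _ C]) (auto simp: abs_le_iff)
  qed
  then obtain C where C: "\<And>i w t. norm w = 1 \<Longrightarrow> \<bar>t\<bar> \<le> \<delta> \<Longrightarrow> \<bar>k2 i w t\<bar> \<le> C i" by metis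
  show "\<exists>C. \<forall>w. norm w = 1 \<longrightarrow> (\<forall>h. 0 < h \<and> h < (1 - norm x) / 2 \<longrightarrow>
      \<bar>second_diff (\<lambda>y. poisson_kernel y w) x h\<bar> \<le> C)"
  proof (intro exI allI impI)
    fix w :: "real^'n" and h :: real assume w: "norm w = 1" and h: "0 < h \<and> h < (1 - norm x) / 2"
    let ?g = "\<lambda>i t. poisson_kernel (x + t *\<^sub>R axis i 1) w"
    have b: "\<bar>(?g i h + ?g i (-h) - 2 * ?g i 0) / h\<^sup>2\<bar> \<le> C i" for i
    proof -
      obtain t where t: "0 < t" "t < h" "?g i h + ?g i (-h) - 2 * ?g i 0 = h\<^sup>2 * ((k2 i w t + k2 i w (-t)) / 2)"
        by (rule symmetric_second_difference[of h "?g i" "k1 i w" "k2 i w"])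
          (use h w in \<open>auto intro!: d1 d2 simp: \<delta>_def\<close>)
      have eq: "(?g i h + ?g i (-h) - 2 * ?g i 0) / h\<^sup>2 = (k2 i w t + k2 i w (-t)) / 2"
        unfolding t(3) using h by simp
      have "\<bar>k2 i w t\<bar> \<le> C i" "\<bar>k2 i w (-t)\<bar> \<le> C i"
        using C[OF w, of t i] C[OF w, of "-t" i] t h by (auto simp: \<delta>_def)
      then show ?thesis unfolding eq by (simp add: abs_le_iff)
    qed
    have "\<bar>second_diff (\<lambda>y. poisson_kernel y w) x h\<bar> = \<bar>\<Sum>i\<in>UNIV. (?g i h + ?g i (-h) - 2 * ?g i 0) / h\<^sup>2\<bar>"
      by (simp add: second_diff_def sum_divide_distrib)
    also have "\<dots> \<le> (\<Sum>i\<in>UNIV. C i)"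
      by (intro order_trans[OF sum_abs] sum_mono b)
    finally show "\<bar>second_diff (\<lambda>y. poisson_kernel y w) x h\<bar> \<le> (\<Sum>i\<in>UNIV. C i)" .
  qed
qed

lemma weakly_harmonic_poisson:
  fixes f :: "real^'n \<Rightarrow> real"
  assumes f [measurable]: "f \<in> borel_measurable sphere_measure"
    and B: "AE w in sphere_measure. \<bar>f w\<bar> \<le> B" and x: "norm x < 1"
  shows "weakly_harmonic_at (poisson f) x"
proof -
  obtain C where C: "\<And>w h. norm w = 1 \<Longrightarrow> 0 < h \<Longrightarrow> h < (1 - norm x) / 2 \<Longrightarrow>
      \<bar>second_diff (\<lambda>y. poisson_kernel y w) x h\<bar> \<le> C"
    using second_diff_poisson_kernel(2)[OF x] by blast
  let ?s = "\<lambda>h w. second_diff (\<lambda>y. poisson_kernel y w) x h * f w"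
  have m: "(\<lambda>w. ?s h w) \<in> borel_measurable sphere_measure" for h
    unfolding second_diff_def by measurable
  \<comment> \<open>The substitution \<open>h = inverse t\<close> turns the right-hand limit at 0
    into a limit at infinity, the form of dominated convergence applied here.\<close>
  have "((\<lambda>t. LINT w|sphere_measure. ?s (inverse t) w) \<longlongrightarrow> (LINT w|(sphere_measure :: (real^'n) measure). 0)) at_top"
  proof (rule integral_dominated_convergence_at_top[where w="\<lambda>_. C * B"])
    show "AE w in sphere_measure. ((\<lambda>t. ?s (inverse t) w) \<longlongrightarrow> 0) at_top"
      using AE_sphere_norm
    proof eventually_elim
      case (elim w)
      have "((\<lambda>h. ?s h w) \<longlongrightarrow> 0) (at_right 0)"
        using second_diff_poisson_kernel(1)[OF x elim] by (rule tendsto_mult_left_zero)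
      then show ?case by (simp add: filterlim_at_right_to_top)
    qed
    have "\<forall>\<^sub>F h in at_right 0. AE w in sphere_measure. norm (?s h w) \<le> C * B"
      unfolding eventually_at_right_field
    proof (intro exI[of _ "(1 - norm x) / 2"] conjI allI impI)
      fix h :: real assume h: "0 < h" "h < (1 - norm x) / 2"
      show "AE w in sphere_measure. norm (?s h w) \<le> C * B"
        using B AE_sphere_norm
      proof eventually_elim
        case (elim w)
        have "\<bar>second_diff (\<lambda>y. poisson_kernel y w) x h\<bar> \<le> C" using C elim h by blast
        then show ?case unfolding real_norm_def abs_mult
          using elim by (intro mult_mono) auto
      qed
    qed (use x in simp)
    then show "\<forall>\<^sub>F t in at_top. AE w in sphere_measure. norm (?s (inverse t) w) \<le> C * B"
      by (simp add: eventually_at_right_to_top)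
  qed (use m in auto)
  then have "((\<lambda>h. LINT w|sphere_measure. ?s h w) \<longlongrightarrow> 0) (at_right 0)"
    by (simp add: filterlim_at_right_to_top)
  moreover have "\<forall>\<^sub>F h in at_right 0. (LINT w|sphere_measure. ?s h w) = second_diff (poisson f) x h"
    unfolding eventually_at_right_field
  proof (intro exI[of _ "1 - norm x"] conjI allI impI)
    fix h :: real assume h: "0 < h" "h < 1 - norm x"
    have I: "integrable sphere_measure (\<lambda>w. poisson_kernel y w * f w)" if "norm y < 1" for y
      using integrable_poisson[OF f _ that] B by simp
    have n: "norm (x + h *\<^sub>R axis i 1) < 1" "norm (x - h *\<^sub>R axis i 1) < 1" for i
      using norm_triangle_ineq[of x "h *\<^sub>R axis i 1"] norm_triangle_ineq4[of x "h *\<^sub>R axis i 1"] h by auto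
    have "second_diff (poisson f) x h = (\<Sum>i\<in>UNIV. (LINT w|sphere_measure.
        poisson_kernel (x + h *\<^sub>R axis i 1) w * f w + poisson_kernel (x - h *\<^sub>R axis i 1) w * f w
        - 2 * (poisson_kernel x w * f w))) / h\<^sup>2"
      by (simp add: second_diff_def poisson_eq I n x)
    also have "\<dots> = (LINT w|sphere_measure. (\<Sum>i\<in>UNIV. 
        poisson_kernel (x + h *\<^sub>R axis i 1) w * f w + poisson_kernel (x - h *\<^sub>R axis i 1) w * f w
        - 2 * (poisson_kernel x w * f w)) / h\<^sup>2)"
      by (simp add: Bochner_Integration.integral_sum I n x)
    also have "\<dots> = (LINT w|sphere_measure. ?s h w)"
      by (intro Bochner_Integration.integral_cong refl)
        (simp add: second_diff_def sum_distrib_left sum_distrib_right algebra_simps)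
    finally show "(LINT w|sphere_measure. ?s h w) = second_diff (poisson f) x h" by simp
  qed (use x in simp)
  ultimately show ?thesis
    unfolding weakly_harmonic_at_def by (rule Lim_transform_eventually)
qed

section \<open>The Poisson representation\<close>

text \<open>Counterpart of \<open>weakly_harmonic_scaled\<close> for functions known only to be
  weakly harmonic, such as Poisson integrals: the second difference of the dilated function with
  step \<open>h\<close> is \<open>c^2\<close> times that of \<open>f\<close> with step
  \<open>c * h\<close>.\<close>

lemma weakly_harmonic_at_scale:
  fixes f :: "real^'n \<Rightarrow> real"
  assumes c: "0 < c" and f: "weakly_harmonic_at f (c *\<^sub>R x)"
  shows "weakly_harmonic_at (\<lambda>y. f (c *\<^sub>R y)) x"
proof -
  have "filterlim (\<lambda>h. c * h) (at_right 0) (at_right 0)"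
    unfolding filterlim_at
  proof
    show "\<forall>\<^sub>F h in at_right 0. c * h \<in> {0<..} \<and> c * h \<noteq> 0"
      using c by (auto simp: eventually_at_right_field intro!: exI[of _ 1])
    show "((\<lambda>h. c * h) \<longlongrightarrow> 0) (at_right 0)"
      by (rule tendsto_mult_right_zero) (rule tendsto_ident_at)
  qed
  then have "((\<lambda>h. second_diff f (c *\<^sub>R x) (c * h)) \<longlongrightarrow> 0) (at_right 0)"
    using f filterlim_compose unfolding weakly_harmonic_at_def by blast
  then have "((\<lambda>h. c\<^sup>2 * second_diff f (c *\<^sub>R x) (c * h)) \<longlongrightarrow> 0) (at_right 0)"
    by (rule tendsto_mult_right_zero)
  moreover have "second_diff (\<lambda>y. f (c *\<^sub>R y)) x = (\<lambda>h. c\<^sup>2 * second_diff f (c *\<^sub>R x) (c * h))"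
    using c by (simp add: fun_eq_iff second_diff_def scaleR_add_right scaleR_diff_right power_mult_distrib)
  ultimately show ?thesis by (simp add: weakly_harmonic_at_def)
qed

lemma poisson_orthogonal:
  fixes T :: "real^'n \<Rightarrow> real^'n" and f :: "real^'n \<Rightarrow> 'b::{banach,second_countable_topology}"
  assumes T: "orthogonal_transformation T" and f [measurable]: "f \<in> borel_measurable sphere_measure"
  shows "poisson (\<lambda>w. f (T w)) x = poisson f (T x)"
proof -
  have "poisson (\<lambda>w. f (T w)) x = (LINT w|sphere_measure. poisson_kernel (T x) (T w) *\<^sub>R f (T w))"
    by (simp add: poisson_eq poisson_kernel_orthogonal[OF T])
  also have "\<dots> = poisson f (T x)"
    unfolding poisson_eq by (rule integral_sphere_orthogonal[OF T, of "\<lambda>w. poisson_kernel (T x) w *\<^sub>R f w"]) measurable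
  finally show ?thesis .
qed

lemma norm_scaleR_less_one:
  fixes y :: "'a::real_normed_vector"
  assumes "0 \<le> \<rho>" "\<rho> < 1" "norm y \<le> 1"
  shows "norm (\<rho> *\<^sub>R y) < 1"
proof -
  have "\<rho> * norm y \<le> \<rho> * 1" using assms by (intro mult_left_mono)
  also have "\<dots> < 1" using assms by simp
  finally show ?thesis using assms by simp
qed

lemma continuous_on_sphere_bounded:
  fixes f :: "'a::euclidean_space \<Rightarrow> 'b::real_normed_vector"
  assumes "continuous_on (sphere 0 1) f"
  obtains B where "\<And>w. norm w = 1 \<Longrightarrow> norm (f w) \<le> B"
proof -
  have "bounded (f ` sphere 0 1)"
    by (intro compact_imp_bounded compact_continuous_image assms compact_sphere)
  then show thesis using that unfolding bounded_iff by (metis image_eqI mem_sphere_0)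
qed

lemma poisson_0:
  fixes f :: "real^'n \<Rightarrow> 'b::{banach,second_countable_topology}"
  assumes [measurable]: "f \<in> borel_measurable sphere_measure"
  shows "poisson f 0 = (LINT w|sphere_measure. f w)"
  unfolding poisson_eq
proof (rule integral_cong_AE)
  show "AE w in sphere_measure. poisson_kernel 0 w *\<^sub>R f w = f w"
    using AE_sphere_norm by eventually_elim (simp add: poisson_kernel_0)
qed measurable

lemma isCont_poisson:
  fixes f :: "real^'n \<Rightarrow> 'b::{banach,second_countable_topology}"
  assumes f [measurable]: "f \<in> borel_measurable sphere_measure"
    and B: "AE w in sphere_measure. norm (f w) \<le> B" and x: "norm x < 1"
  shows "isCont (poisson f) x"
proof (rule continuous_at_sequentiallyI)
  fix u assume u: "u \<longlonglongrightarrow> x"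
  \<comment> \<open>A radius strictly between \<open>norm x\<close> and 1: a tail of the sequence
    stays below it, which gives one dominating constant.\<close>
  define r where "r = (1 + norm x) / 2"
  have r: "norm x < r" "r < 1" using x by (auto simp: r_def)
  have "\<forall>\<^sub>F n in sequentially. norm (u n) < r"
    using tendsto_norm[OF u] r(1) by (rule order_tendstoD)
  then obtain k where k: "\<And>n. norm (u (n + k)) < r"
    unfolding eventually_sequentially by (metis le_add2)
  have uk: "(\<lambda>n. u (n + k)) \<longlonglongrightarrow> x" using u by (rule LIMSEQ_ignore_initial_segment)
  have "(\<lambda>n. LINT w|sphere_measure. poisson_kernel (u (n + k)) w *\<^sub>R f w)
      \<longlonglongrightarrow> (LINT w|sphere_measure. poisson_kernel x w *\<^sub>R f w)"
  proof (rule integral_dominated_convergence[where w="\<lambda>_. 1 / (1 - r) ^ CARD('n) * B"])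
    show "AE w in sphere_measure. (\<lambda>n. poisson_kernel (u (n + k)) w *\<^sub>R f w) \<longlonglongrightarrow> poisson_kernel x w *\<^sub>R f w"
      using AE_sphere_norm
    proof eventually_elim
      case (elim w)
      then have "norm (x - w) \<noteq> 0" using x by auto
      then show ?case unfolding poisson_kernel_def by (intro tendsto_intros uk) auto
    qed
    show "AE w in sphere_measure. norm (poisson_kernel (u (n + k)) w *\<^sub>R f w) \<le> 1 / (1 - r) ^ CARD('n) * B" for n
      using AE_sphere_norm B
    proof eventually_elim
      case (elim w)
      have "\<bar>poisson_kernel (u (n + k)) w\<bar> \<le> 1 / (1 - norm (u (n + k))) ^ CARD('n)"
        using k[of n] r elim by (intro poisson_kernel_bound) auto
      also have "\<dots> \<le> 1 / (1 - r) ^ CARD('n)"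
        using k[of n] r by (intro divide_left_mono power_mono mult_pos_pos zero_less_power) auto
      finally show ?case unfolding norm_scaleR
        using elim r by (intro mult_mono) auto
    qed
  qed auto
  then have "(\<lambda>n. poisson f (u (n + k))) \<longlonglongrightarrow> poisson f x" by (simp add: poisson_eq)
  then show "(\<lambda>n. poisson f (u n)) \<longlonglongrightarrow> poisson f x" by (rule LIMSEQ_offset)
qed

lemma poisson_one:
  fixes x :: "real^'n"
  assumes x: "norm x < 1"
  shows "poisson (\<lambda>_. 1 :: real) x = 1"
proof (cases "x = 0")
  case True
  then show ?thesis by (simp add: poisson_0 space_sphere_measure)
next
  case False
  define \<rho> where "\<rho> = norm x"
  have \<rho>: "0 < \<rho>" "\<rho> < 1" using False x by (auto simp: \<rho>_def)
  let ?h = "poisson (\<lambda>_::real^'n. 1 :: real)"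
  have lt: "norm (\<rho> *\<^sub>R y) < 1" if "norm y \<le> 1" for y :: "real^'n"
    using \<rho> that by (intro norm_scaleR_less_one) auto
  \<comment> \<open>\<open>?h\<close> is radial, hence constant on the sphere of radius \<open>\<rho>\<close>, hence constant inside it.\<close>
  have "?h (\<rho> *\<^sub>R 0) = ?h x"
  proof (rule weakly_harmonic_eqI[of "\<lambda>y. ?h (\<rho> *\<^sub>R y)" "\<lambda>_. ?h x"])
    have "isCont ?h y" if "norm y < 1" for y using that by (intro isCont_poisson[of _ 1]) auto
    then have "continuous_on (ball 0 1) ?h" by (simp add: continuous_at_imp_continuous_on)
    then show "continuous_on (cball 0 1) (\<lambda>y. ?h (\<rho> *\<^sub>R y))"
      by (rule continuous_on_compose2) (use lt in \<open>auto intro!: continuous_intros\<close>)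
    show "weakly_harmonic_at (\<lambda>y. ?h (\<rho> *\<^sub>R y)) y" if "y \<in> ball 0 1" for y
      using that lt[of y] by (intro weakly_harmonic_at_scale \<rho> weakly_harmonic_poisson[of _ 1]) auto
    show "?h (\<rho> *\<^sub>R y) = ?h x" if "y \<in> sphere 0 1" for y
    proof -
      have "norm (\<rho> *\<^sub>R y) = norm x" using that \<rho> by (simp add: \<rho>_def)
      then obtain T where "orthogonal_transformation T" "T (\<rho> *\<^sub>R y) = x"
        by (rule orthogonal_transformation_exists)
      then show ?thesis using poisson_orthogonal[of T "\<lambda>_. 1 :: real" "\<rho> *\<^sub>R y"] by simp
    qed
  qed (auto intro: weakly_harmonic_at_const)
  then show ?thesis by (simp add: poisson_0 space_sphere_measure)
qed

section \<open>Boundary behaviour and the Dirichlet problem\<close>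

text \<open>Near \<open>y\<close> the kernel is controlled by its total mass 1, far from
  \<open>y\<close> by \<open>poisson_kernel_le\<close>. Bounding the integrand by the sum of both
  contributions avoids splitting the integral.\<close>

lemma poisson_boundary_estimate:
  fixes f :: "real^'n \<Rightarrow> real"
  assumes f [measurable]: "f \<in> borel_measurable sphere_measure"
    and B: "\<And>w. norm w = 1 \<Longrightarrow> \<bar>f w - c\<bar> \<le> B" and d: "0 < d" and e: "0 \<le> e"
    and near: "\<And>w. norm w = 1 \<Longrightarrow> norm (w - y) < d \<Longrightarrow> \<bar>f w - c\<bar> \<le> e"
    and y: "norm y < 1"
  shows "\<bar>poisson f y - c\<bar> \<le> e + B * ((1 - (norm y)\<^sup>2) / d ^ CARD('n))"
proof -
  let ?S = "sphere_measure :: (real^'n) measure"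
  let ?K = "(1 - (norm y)\<^sup>2) / d ^ CARD('n)"
  have K: "0 \<le> ?K" using y d by (simp add: power_le_one)
  \<comment> \<open>Any unit vector would do; it only witnesses that the sphere is nonempty.\<close>
  have "0 \<le> B" using B[of "axis undefined 1"] by auto
  have Bf: "AE w in ?S. norm (f w) \<le> B + \<bar>c\<bar>"
    using AE_sphere_norm
  proof eventually_elim
    case (elim w) then show ?case using B[of w] by auto
  qed
  have If: "integrable ?S (\<lambda>w. poisson_kernel y w * f w)"
    using integrable_poisson[OF f Bf y] by simp
  have I1: "integrable ?S (\<lambda>w. poisson_kernel y w * a)" for a
    using integrable_poisson[of "\<lambda>_. a" "\<bar>a\<bar>" y] y by simp
  have one: "(LINT w|?S. poisson_kernel y w) = 1"
    using poisson_one[OF y] by (simp add: poisson_eq)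
  have "poisson f y - c = (LINT w|?S. poisson_kernel y w * f w - poisson_kernel y w * c)"
    by (subst Bochner_Integration.integral_diff[OF If I1]) (simp add: one poisson_eq)
  also have "\<bar>\<dots>\<bar> \<le> (LINT w|?S. \<bar>poisson_kernel y w * f w - poisson_kernel y w * c\<bar>)"
    by (rule integral_abs_bound)
  also have "\<dots> \<le> (LINT w|?S. poisson_kernel y w * e + B * ?K)"
  proof (rule integral_mono_AE)
    show "AE w in ?S. \<bar>poisson_kernel y w * f w - poisson_kernel y w * c\<bar> \<le> poisson_kernel y w * e + B * ?K"
      using AE_sphere_norm
    proof eventually_elim
      case (elim w)
      have p: "0 < poisson_kernel y w" using poisson_kernel_pos[OF y elim] .
      have eq: "\<bar>poisson_kernel y w * f w - poisson_kernel y w * c\<bar> = poisson_kernel y w * \<bar>f w - c\<bar>"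
        using p by (simp add: abs_mult right_diff_distrib[symmetric])
      show ?case
      proof (cases "norm (w - y) < d")
        case True
        have "poisson_kernel y w * \<bar>f w - c\<bar> \<le> poisson_kernel y w * e"
          using near[OF elim True] p by (intro mult_left_mono) auto
        then show ?thesis unfolding eq using mult_nonneg_nonneg[OF \<open>0 \<le> B\<close> K] by linarith
      next
        case False
        have "poisson_kernel y w \<le> ?K"
          using False y d by (intro poisson_kernel_le) (auto simp: norm_minus_commute)
        then have "poisson_kernel y w * \<bar>f w - c\<bar> \<le> ?K * B"
          using B[OF elim] K by (intro mult_mono) auto
        moreover have "0 \<le> poisson_kernel y w * e" using p e by simp
        ultimately show ?thesis unfolding eq by (simp add: mult.commute)
      qed
    qed
  qed (use If I1 in auto)
  also have "\<dots> = e + B * ?K"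
    using I1 by (simp add: one space_sphere_measure)
  finally show ?thesis .
qed

text \<open>The Poisson integral inside, completed by \<open>F\<close> itself on the sphere, is
  continuous on the closed ball and weakly harmonic inside, so uniqueness identifies it with
  \<open>F\<close>. The work lies in the continuity at boundary points.\<close>

lemma poisson_representation:
  fixes F :: "real^'n \<Rightarrow> real"
  assumes cont: "continuous_on (cball 0 1) F"
    and harm: "\<And>x. x \<in> ball 0 1 \<Longrightarrow> weakly_harmonic_at F x" and x: "norm x < 1"
  shows "poisson F x = F x"
proof -
  let ?G = "\<lambda>x. if norm x < 1 then poisson F x else F x"
  have contS: "continuous_on (sphere 0 1) F" using cont by (rule continuous_on_subset) auto
  have m: "F \<in> borel_measurable sphere_measure" by (intro continuous_on_sphere_measurable contS)
  obtain B where B: "\<And>w. norm w = 1 \<Longrightarrow> \<bar>F w\<bar> \<le> B"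
    using continuous_on_sphere_bounded[OF contS] unfolding real_norm_def by blast
  have BAE: "AE w in sphere_measure. norm (F w) \<le> B"
    using AE_sphere_norm by eventually_elim (simp add: B)
  have "continuous_on (cball 0 1) ?G"
    unfolding continuous_on_def
  proof
    fix z :: "real^'n" assume z: "z \<in> cball 0 1"
    show "(?G \<longlongrightarrow> ?G z) (at z within cball 0 1)"
    proof (cases "norm z < 1")
      case True
      have "(poisson F \<longlongrightarrow> poisson F z) (at z)"
        using isCont_poisson[OF m BAE True] by (simp add: isCont_def)
      moreover have "\<forall>\<^sub>F y in at z. poisson F y = ?G y"
        unfolding eventually_at_topological
        using True by (intro exI[of _ "ball 0 1"]) auto
      ultimately have "(?G \<longlongrightarrow> poisson F z) (at z)" by (rule Lim_transform_eventually)
      then show ?thesis using True by (simp add: Lim_at_imp_Lim_at_within)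
    next
      case False
      then have nz: "norm z = 1" using z by simp
      show ?thesis
      proof (rule tendstoI)
        fix e :: real assume e: "e > 0"
        obtain d where d: "d > 0" "\<And>y. y \<in> cball 0 1 \<Longrightarrow> dist y z < d \<Longrightarrow> \<bar>F y - F z\<bar> < e / 2"
          using cont z e unfolding continuous_on_iff dist_real_def
          by (metis half_gt_zero)
        \<comment> \<open>Chosen so that \<open>1 - (norm y)^2 \<le> M\<close> makes the far
          contribution at most \<open>2 * B * e / (4 * (B + 1))\<close>, which is below
          \<open>e / 2\<close>; \<open>B + 1\<close> covers \<open>B = 0\<close>.\<close>
        define M where "M = e / (4 * (B + 1)) * (d / 2) ^ CARD('n)"
        \<comment> \<open>The first entry serves the triangle inequality through \<open>y\<close>;
          the second suffices since
          \<open>1 - (norm y)^2 \<le> 2 * (1 - norm y) \<le> 2 * norm (y - z)\<close>.\<close>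
        define \<eta> where "\<eta> = min (d / 2) (M / 2)"
        have B0: "0 \<le> B" using B[OF nz] by linarith
        have \<eta>: "\<eta> > 0" using d e B0 by (simp add: \<eta>_def M_def)
        show "\<forall>\<^sub>F y in at z within cball 0 1. dist (?G y) (?G z) < e"
          unfolding eventually_at
        proof (intro exI[of _ \<eta>] conjI ballI impI \<eta>)
          fix y assume y: "y \<in> cball 0 1" "y \<noteq> z \<and> dist y z < \<eta>"
          show "dist (?G y) (?G z) < e"
          proof (cases "norm y < 1")
            case True
            have dz: "norm (y - z) < \<eta>" using y by (simp add: dist_norm)
            have "\<bar>poisson F y - F z\<bar> \<le> e / 2 + 2 * B * ((1 - (norm y)\<^sup>2) / (d / 2) ^ CARD('n))"
            proof (rule poisson_boundary_estimate[OF m _ _ _ _ True])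
              show "\<bar>F w - F z\<bar> \<le> 2 * B" if "norm w = 1" for w
                using B[OF that] B[OF nz] by linarith
              show "\<bar>F w - F z\<bar> \<le> e / 2" if "norm w = 1" "norm (w - y) < d / 2" for w
              proof -
                have "norm (w - z) \<le> norm (w - y) + norm (y - z)"
                  using norm_triangle_ineq[of "w - y" "y - z"] by simp
                also have "\<dots> < d" using that dz by (simp add: \<eta>_def)
                finally show ?thesis using d(2)[of w] that by (simp add: dist_norm)
              qed
            qed (use d e in simp_all)
            also have "\<dots> < e"
            proof -
              have "1 - norm y \<le> norm (y - z)"
                using norm_triangle_ineq2[of z y] nz by (simp add: norm_minus_commute)
              moreover have "1 - (norm y)\<^sup>2 \<le> 2 - 2 * norm y"
                using zero_le_power2[of "1 - norm y"] by (simp add: power2_eq_square algebra_simps)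
              ultimately have "1 - (norm y)\<^sup>2 \<le> 2 * \<eta>" using dz by linarith
              also have "\<dots> \<le> M" by (simp add: \<eta>_def min_def)
              finally have "(1 - (norm y)\<^sup>2) / (d / 2) ^ CARD('n) \<le> e / (4 * (B + 1))"
                unfolding M_def using d by (simp add: pos_divide_le_eq)
              then have "2 * B * ((1 - (norm y)\<^sup>2) / (d / 2) ^ CARD('n)) \<le> 2 * B * (e / (4 * (B + 1)))"
                using B0 by (intro mult_left_mono) auto
              also have "\<dots> < e / 2" using B0 e by (simp add: field_simps)
              finally show ?thesis by simp
            qed
            finally show ?thesis using True nz by (simp add: dist_real_def)
          next
            case False
            have "dist y z < \<eta>" "0 \<le> dist y z" using y by auto
            then have "dist y z < d" using d(1) by (simp add: \<eta>_def)
            then have "\<bar>F y - F z\<bar> < e" using d(2)[OF y(1)] e by linarith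
            then show ?thesis using False nz by (simp add: dist_real_def)
          qed
        qed
      qed
    qed
  qed
  moreover have "weakly_harmonic_at ?G x" if "x \<in> ball 0 1" for x
    using weakly_harmonic_at_cong[OF open_ball that, of ?G "poisson F"]
      weakly_harmonic_poisson[OF m] BAE that by auto
  ultimately have "?G x = F x"
    by (rule weakly_harmonic_eqI[OF _ cont _ harm]) (use x in auto)
  then show ?thesis using x by simp
qed

lemma poisson_vec_nth:
  fixes f :: "real^'n \<Rightarrow> real^'k"
  assumes "f \<in> borel_measurable sphere_measure"
    and "AE w in sphere_measure. norm (f w) \<le> B" and "norm x < 1"
  shows "poisson f x $ k = poisson (\<lambda>w. f w $ k) x"
proof -
  have "(LINT w|sphere_measure. (poisson_kernel x w *\<^sub>R f w) $ k) = poisson f x $ k"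
    unfolding poisson_eq by (rule integral_bounded_linear[OF bounded_linear_vec_nth integrable_poisson[OF assms]])
  then show ?thesis by (simp add: poisson_eq)
qed

lemma harmonic_map_poisson:
  fixes F :: "real^'n \<Rightarrow> real^'k"
  assumes F: "harmonic_map_on (ball 0 1) F" and \<rho>: "0 \<le> \<rho>" "\<rho> < 1" and x: "norm x < 1"
  shows "poisson (\<lambda>w. F (\<rho> *\<^sub>R w)) x = F (\<rho> *\<^sub>R x)"
proof -
  have lt: "norm (\<rho> *\<^sub>R y) < 1" if "norm y \<le> 1" for y :: "real^'n"
    using \<rho> that by (intro norm_scaleR_less_one) auto
  have C2: "C2_on (ball 0 1) (\<lambda>x. F x $ k)" and L: "\<And>x. x \<in> ball 0 1 \<Longrightarrow> laplacian (\<lambda>x. F x $ k) x = 0" for k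
    using F by (auto simp: harmonic_map_on_def)
  have c: "continuous_on (cball 0 1) (\<lambda>y. F (\<rho> *\<^sub>R y) $ k)" for k
  proof -
    have "continuous_on (ball 0 1) (\<lambda>x. F x $ k)"
      using C2[of k] by (simp add: C2_on_def differentiable_imp_continuous_on)
    then show ?thesis
      by (rule continuous_on_compose2) (use lt in \<open>auto intro!: continuous_intros\<close>)
  qed
  then have cv: "continuous_on (cball 0 1) (\<lambda>y. F (\<rho> *\<^sub>R y))"
    using continuous_on_vec_lambda[of "cball 0 1" "\<lambda>k y. F (\<rho> *\<^sub>R y) $ k"] by simp
  then have cS: "continuous_on (sphere 0 1) (\<lambda>y. F (\<rho> *\<^sub>R y))"
    by (rule continuous_on_subset) auto
  obtain B where B: "\<And>w. norm w = 1 \<Longrightarrow> norm (F (\<rho> *\<^sub>R w)) \<le> B"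
    using continuous_on_sphere_bounded[OF cS] by blast
  have BAE: "AE w in sphere_measure. norm (F (\<rho> *\<^sub>R w)) \<le> B"
    using AE_sphere_norm by eventually_elim (simp add: B)
  show ?thesis
  proof (simp add: vec_eq_iff poisson_vec_nth[OF continuous_on_sphere_measurable[OF cS] BAE x], intro allI)
    fix k
    show "poisson (\<lambda>w. F (\<rho> *\<^sub>R w) $ k) x = F (\<rho> *\<^sub>R x) $ k"
    proof (rule poisson_representation[OF c _ x])
      fix y :: "real^'n" assume "y \<in> ball 0 1"
      then show "weakly_harmonic_at (\<lambda>y. F (\<rho> *\<^sub>R y) $ k) y"
        using weakly_harmonic_scaled[OF open_ball C2 L, where c = \<rho> and x = y] lt[of y] by simp
    qed
  qed
qed

section \<open>The extremal problem\<close>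

text \<open>A quantitative Cauchy-Schwarz inequality: the deficit
  \<open>norm v - v \<bullet> f\<close> controls the distance of \<open>f\<close> from the optimal
  direction. Zero deficit gives uniqueness, small deficit gives stability.\<close>

lemma norm_diff_sgn_le:
  fixes f v :: "'b::real_inner"
  assumes f: "norm f \<le> 1" and v: "v \<noteq> 0"
  shows "(norm (f - sgn v))\<^sup>2 * norm v \<le> 2 * (norm v - v \<bullet> f)"
proof -
  have "sgn v \<bullet> sgn v = 1" using v by (simp add: dot_square_norm norm_sgn)
  then have "(norm (f - sgn v))\<^sup>2 = f \<bullet> f - 2 * (f \<bullet> sgn v) + 1"
    unfolding power2_norm_eq_inner
    by (simp add: inner_diff_left inner_diff_right inner_commute[of "sgn v" f])
  also have "\<dots> \<le> 2 - 2 * (f \<bullet> sgn v)"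
    using f by (simp add: dot_square_norm power_le_one)
  also have "f \<bullet> sgn v = (v \<bullet> f) / norm v"
    by (simp add: sgn_div_norm inner_commute divide_inverse mult.commute)
  finally show ?thesis using v by (simp add: field_simps)
qed

lemma inner_sgn_self: "(v::'b::real_inner) \<bullet> sgn v = norm v"
  by (cases "v = 0") (simp_all add: sgn_div_norm dot_square_norm power2_eq_square)

text \<open>The kernel enters the duality only through boundedness and null level sets.
  \<open>norm p < 1\<close> supplies coercivity of the dual function.\<close>

locale extremal_problem =
  fixes K :: "real^'n \<Rightarrow> real" and \<epsilon> p :: "'b::euclidean_space" and C :: real
  assumes K_measurable [measurable]: "K \<in> borel_measurable sphere_measure"
    and K_bound: "AE w in sphere_measure. \<bar>K w\<bar> \<le> C"
    and K_neq: "\<And>s. AE w in sphere_measure. K w \<noteq> s"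
    and unit: "norm \<epsilon> = 1" and p: "norm p < 1"
begin

definition field :: "'b \<Rightarrow> real^'n \<Rightarrow> 'b" where
  "field y w = K w *\<^sub>R \<epsilon> + y"

lemma field_measurable [measurable]: "field y \<in> borel_measurable sphere_measure"
  unfolding field_def by measurable

lemma field_bound: "AE w in sphere_measure. norm (field y w) \<le> C + norm y"
  using K_bound
proof eventually_elim
  case (elim w)
  then show ?case
    using norm_triangle_ineq[of "K w *\<^sub>R \<epsilon>" y] unit by (simp add: field_def)
qed

text \<open>The component of the field along \<open>\<epsilon>\<close> is
  \<open>K w + y \<bullet> \<epsilon>\<close>, so the field can vanish only on a level set of
  \<open>K\<close>.\<close>

lemma field_neq_0: "AE w in sphere_measure. field y w \<noteq> 0"
  using K_neq[of "- (y \<bullet> \<epsilon>)"]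
proof eventually_elim
  case (elim w)
  have "field y w \<bullet> \<epsilon> = K w + y \<bullet> \<epsilon>"
    using unit by (simp add: field_def inner_add_left dot_square_norm)
  then show ?case using elim by auto
qed

lemma integrable_inner_field:
  assumes [measurable]: "f \<in> borel_measurable sphere_measure"
    and f: "AE w in sphere_measure. norm (f w) \<le> 1"
  shows "integrable sphere_measure (\<lambda>w. field y w \<bullet> f w)"
proof (rule sphere.integrable_const_bound)
  show "AE w in sphere_measure. norm (field y w \<bullet> f w) \<le> (C + norm y) * 1"
    using field_bound[of y] f
  proof eventually_elim
    case (elim w)
    have "\<bar>field y w \<bullet> f w\<bar> \<le> norm (field y w) * norm (f w)" by (rule Cauchy_Schwarz_ineq2)
    also have "\<dots> \<le> (C + norm y) * 1"
      using elim order_trans[OF norm_ge_zero elim(1)] by (intro mult_mono) auto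
    finally show ?case by simp
  qed
qed measurable

lemma integrable_unit:
  assumes "f \<in> borel_measurable sphere_measure" "AE w in sphere_measure. norm (f w) \<le> 1"
  shows "integrable sphere_measure (f :: real^'n \<Rightarrow> 'b)"
  by (rule sphere.integrable_const_bound[OF assms(2,1)])

lemma norm_sgn_le: "AE w in sphere_measure. norm (sgn (field y w)) \<le> 1"
  by (simp add: norm_sgn)

lemma integrable_norm_field: "integrable sphere_measure (\<lambda>w. norm (field y w))"
  by (rule sphere.integrable_const_bound[of _ "C + norm y"]) (use field_bound in auto)

lemma inner_field: "field y w \<bullet> z = K w * (z \<bullet> \<epsilon>) + y \<bullet> z"
  by (simp add: field_def inner_add_left inner_commute[of \<epsilon>])

text \<open>\<open>y\<close> is the multiplier of the mean constraint. On fields of mean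
  \<open>p\<close> this is the objective plus the constant \<open>y \<bullet> p\<close>.\<close>

definition lagrangian :: "'b \<Rightarrow> (real^'n \<Rightarrow> 'b) \<Rightarrow> real" where
  "lagrangian y f = (LINT w|sphere_measure. K w * (f w \<bullet> \<epsilon>)) + y \<bullet> (LINT w|sphere_measure. f w)"

lemma integral_inner_field:
  assumes f [measurable]: "f \<in> borel_measurable sphere_measure"
    and "AE w in sphere_measure. norm (f w) \<le> 1"
  shows "(LINT w|sphere_measure. field y w \<bullet> f w) = lagrangian y f"
proof -
  note I = integrable_unit[OF assms]
  have "integrable sphere_measure (\<lambda>w. field y w \<bullet> f w - y \<bullet> f w)"
    using integrable_inner_field[OF assms] I by auto
  then have "integrable sphere_measure (\<lambda>w. K w * (f w \<bullet> \<epsilon>))"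
    by (simp add: inner_field)
  with I show ?thesis by (simp add: inner_field lagrangian_def)
qed

text \<open>The gradient of \<open>dual\<close> at \<open>y\<close> is the mean of \<open>sgn (field y w)\<close> minus \<open>p\<close>.\<close>

definition dual :: "'b \<Rightarrow> real" where
  "dual y = (LINT w|sphere_measure. norm (field y w)) - y \<bullet> p"

lemma dual_lipschitz: "\<bar>dual y - dual z\<bar> \<le> 2 * norm (y - z)"
proof -
  have "\<bar>(LINT w|sphere_measure. norm (field y w)) - (LINT w|sphere_measure. norm (field z w))\<bar>
    = \<bar>LINT w|sphere_measure. norm (field y w) - norm (field z w)\<bar>"
    using integrable_norm_field by simp
  also have "\<dots> \<le> (LINT w|(sphere_measure :: (real^'n) measure). norm (y - z))"
  proof (rule order_trans[OF integral_abs_bound], rule integral_mono)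
    show "\<bar>norm (field y w) - norm (field z w)\<bar> \<le> norm (y - z)" for w
      using norm_triangle_ineq3[of "field y w" "field z w"] by (simp add: field_def)
  qed (use integrable_norm_field in auto)
  finally have 1: "\<bar>(LINT w|sphere_measure. norm (field y w)) - (LINT w|sphere_measure. norm (field z w))\<bar> \<le> norm (y - z)"
    by (simp add: space_sphere_measure)
  have "\<bar>(y - z) \<bullet> p\<bar> \<le> norm (y - z) * norm p" by (rule Cauchy_Schwarz_ineq2)
  also have "\<dots> \<le> norm (y - z)" using p by (intro mult_left_le) auto
  finally have "\<bar>y \<bullet> p - z \<bullet> p\<bar> \<le> norm (y - z)" by (simp add: inner_diff_left)
  with 1 show ?thesis unfolding dual_def by linarith
qed

text \<open>The integral grows at least like \<open>norm y\<close>, the linear term at most like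
  \<open>norm y * norm p\<close>; the difference of slopes is positive.\<close>

lemma dual_coercive: "(1 - norm p) * norm y - C \<le> dual y"
proof -
  have "(LINT w|(sphere_measure :: (real^'n) measure). norm y - C) \<le> (LINT w|sphere_measure. norm (field y w))"
  proof (rule integral_mono_AE)
    show "AE w in sphere_measure. norm y - C \<le> norm (field y w)"
      using K_bound
    proof eventually_elim
      case (elim w)
      then show ?case
        using norm_triangle_ineq2[of y "- (K w *\<^sub>R \<epsilon>)"] unit by (simp add: field_def add.commute)
    qed
  qed (use integrable_norm_field in auto)
  moreover have "y \<bullet> p \<le> norm y * norm p" by (rule norm_cauchy_schwarz)
  ultimately show ?thesis by (simp add: dual_def space_sphere_measure algebra_simps)
qed

lemma dual_minimum: "\<exists>y. \<forall>z. dual y \<le> dual z"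
proof -
  \<comment> \<open>Beyond this radius coercivity gives \<open>dual z \<ge> dual 0\<close>. The
    absolute value guarantees that 0 lies in the ball.\<close>
  define R where "R = \<bar>(C + dual 0) / (1 - norm p)\<bar>"
  have "continuous_on (cball 0 R) dual"
  proof (rule continuous_onI)
    fix x :: 'b and e :: real assume "0 < e"
    then show "\<exists>d>0. \<forall>x'\<in>cball 0 R. dist x' x < d \<longrightarrow> dist (dual x') (dual x) \<le> e"
    proof (intro exI[of _ "e / 2"] conjI ballI impI)
      fix z assume "dist z x < e / 2"
      then show "dist (dual z) (dual x) \<le> e"
        using dual_lipschitz[of z x] by (simp add: dist_norm dist_real_def)
    qed simp
  qed
  moreover have R0: "0 \<le> R" unfolding R_def by (rule abs_ge_zero)
  then have "cball 0 R \<noteq> ({} :: 'b set)" by simp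
  ultimately obtain y where y: "\<And>z. z \<in> cball 0 R \<Longrightarrow> dual y \<le> dual z"
    using continuous_attains_inf[OF compact_cball] by blast
  have "dual y \<le> dual z" for z
  proof (cases "norm z \<le> R")
    case True then show ?thesis using y by simp
  next
    case False
    have "(C + dual 0) / (1 - norm p) \<le> norm z" using False unfolding R_def by linarith
    then have "C + dual 0 \<le> (1 - norm p) * norm z" using p by (simp add: field_simps)
    then have "dual 0 \<le> dual z" using dual_coercive[of z] by linarith
    then show ?thesis using y[of 0] R0 by simp
  qed
  then show ?thesis by blast
qed

text \<open>The one-sided derivative of \<open>dual\<close> at a minimum is taken only in the
  direction \<open>d\<close> of the defect itself. It equals \<open>- (d \<bullet> d)\<close> and is
  nonnegative, so \<open>d = 0\<close>. The norm is differentiable along the field because the field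
  is nonzero almost everywhere, and \<open>norm d\<close> dominates the difference
  quotients.\<close>

lemma mean_sgn_field: obtains y where "(LINT w|sphere_measure. sgn (field y w)) = p"
proof -
  obtain y where y: "\<And>z. dual y \<le> dual z" using dual_minimum by blast
  define d where "d = p - (LINT w|sphere_measure. sgn (field y w))"
  define t where "t k = inverse (real (Suc k))" for k
  have t: "0 < t k" for k by (simp add: t_def)
  have tl: "t \<longlonglongrightarrow> 0" unfolding t_def by (rule LIMSEQ_inverse_real_of_nat)
  have fd: "field (y + s *\<^sub>R d) w = field y w + s *\<^sub>R d" for s w by (simp add: field_def)
  let ?q = "\<lambda>k w. (norm (field (y + t k *\<^sub>R d) w) - norm (field y w)) / t k"
  have "(\<lambda>k. LINT w|sphere_measure. ?q k w) \<longlonglongrightarrow> (LINT w|sphere_measure. sgn (field y w) \<bullet> d)"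
  proof (rule integral_dominated_convergence[where w="\<lambda>_. norm d"])
    show "AE w in sphere_measure. (\<lambda>k. ?q k w) \<longlonglongrightarrow> sgn (field y w) \<bullet> d"
      using field_neq_0[of y]
    proof eventually_elim
      case (elim w)
      let ?v = "field y w"
      have "(norm has_derivative (\<lambda>h. sgn ?v \<bullet> h)) (at (?v + 0 *\<^sub>R d))"
        using has_derivative_norm[of ?v] elim by (simp add: inner_commute)
      moreover have "((\<lambda>s. ?v + s *\<^sub>R d) has_derivative (\<lambda>s. s *\<^sub>R d)) (at 0)"
        by (auto intro!: derivative_eq_intros)
      ultimately have "((\<lambda>s. norm (?v + s *\<^sub>R d)) has_derivative (\<lambda>s. sgn ?v \<bullet> (s *\<^sub>R d))) (at 0)"
        by (rule has_derivative_compose[rotated])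
      moreover have "(\<lambda>s. sgn ?v \<bullet> (s *\<^sub>R d)) = (*) (sgn ?v \<bullet> d)"
        by (simp add: fun_eq_iff mult.commute)
      ultimately have "((\<lambda>s. norm (?v + s *\<^sub>R d)) has_real_derivative (sgn ?v \<bullet> d)) (at 0)"
        by (simp only: has_field_derivative_def)
      then have "((\<lambda>h. (norm (?v + h *\<^sub>R d) - norm ?v) / h) \<longlongrightarrow> sgn ?v \<bullet> d) (at 0)"
        by (simp add: DERIV_def)
      moreover have "filterlim t (at 0) sequentially"
        by (rule filterlim_atI[OF tl]) (simp add: t_def)
      ultimately show ?case unfolding fd by (rule filterlim_compose)
    qed
    show "AE w in sphere_measure. norm (?q k w) \<le> norm d" for k
    proof (intro AE_I2)
      fix w
      have "\<bar>norm (field y w + t k *\<^sub>R d) - norm (field y w)\<bar> \<le> t k * norm d"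
        using norm_triangle_ineq3[of "field y w + t k *\<^sub>R d" "field y w"] t[of k] by simp
      then show "norm (?q k w) \<le> norm d"
        using t[of k] by (simp add: fd abs_divide pos_divide_le_eq mult.commute)
    qed
  qed auto
  moreover have "p \<bullet> d \<le> (LINT w|sphere_measure. ?q k w)" for k
  proof -
    have "(LINT w|sphere_measure. ?q k w)
        = ((LINT w|sphere_measure. norm (field (y + t k *\<^sub>R d) w)) - (LINT w|sphere_measure. norm (field y w))) / t k"
      using integrable_norm_field by simp
    also have "\<dots> = (dual (y + t k *\<^sub>R d) - dual y + (p \<bullet> d) * t k) / t k"
      by (simp add: dual_def inner_add_left inner_commute[of p d])
    also have "p \<bullet> d \<le> \<dots>" using y[of "y + t k *\<^sub>R d"] t[of k] by (simp add: pos_le_divide_eq)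
    finally show ?thesis .
  qed
  ultimately have "p \<bullet> d \<le> (LINT w|sphere_measure. sgn (field y w) \<bullet> d)"
    by (intro LIMSEQ_le_const) auto
  also have "\<dots> = (LINT w|sphere_measure. sgn (field y w)) \<bullet> d"
    using integrable_unit[OF _ norm_sgn_le, of y] by simp
  finally have "d \<bullet> d \<le> 0" by (simp add: d_def inner_diff_left)
  then have "d \<bullet> d = 0" using inner_ge_zero[of d] by linarith
  then have "d = 0" by simp
  then show thesis using that[of y] by (simp add: d_def)
qed

section \<open>Optimality, uniqueness and stability\<close>

text \<open>The loss of a competitor becomes the integral of a pointwise Cauchy-Schwarz deficit, so
  comparing Lagrangians turns into a pointwise question.\<close>

lemma integral_gap:
  assumes f [measurable]: "f \<in> borel_measurable sphere_measure"
    and f1: "AE w in sphere_measure. norm (f w) \<le> 1"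
  shows "(LINT w|sphere_measure. norm (field y w) - field y w \<bullet> f w)
    = lagrangian y (\<lambda>w. sgn (field y w)) - lagrangian y f"
proof -
  have "(LINT w|sphere_measure. norm (field y w)) = (LINT w|sphere_measure. field y w \<bullet> sgn (field y w))"
    by (simp add: inner_sgn_self)
  also have "\<dots> = lagrangian y (\<lambda>w. sgn (field y w))"
    by (rule integral_inner_field) (auto simp: norm_sgn)
  finally show ?thesis
    by (simp add: integrable_norm_field integrable_inner_field[OF assms] integral_inner_field[OF assms])
qed

lemma gap_nonneg:
  assumes "AE w in sphere_measure. norm (f w) \<le> 1"
  shows "AE w in sphere_measure. 0 \<le> norm (field y w) - field y w \<bullet> f w"
  using assms
proof eventually_elim
  case (elim w)
  have "field y w \<bullet> f w \<le> norm (field y w) * norm (f w)" by (rule norm_cauchy_schwarz)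
  also have "\<dots> \<le> norm (field y w)" using elim by (intro mult_left_le) auto
  finally show ?case by simp
qed

lemma
  assumes f [measurable]: "f \<in> borel_measurable sphere_measure"
    and f1: "AE w in sphere_measure. norm (f w) \<le> 1"
  shows lagrangian_le: "lagrangian y f \<le> lagrangian y (\<lambda>w. sgn (field y w))"
    and lagrangian_unique: "lagrangian y f = lagrangian y (\<lambda>w. sgn (field y w))
      \<Longrightarrow> AE w in sphere_measure. f w = sgn (field y w)"
proof -
  have "0 \<le> (LINT w|sphere_measure. norm (field y w) - field y w \<bullet> f w)"
    by (rule integral_nonneg_AE[OF gap_nonneg[OF f1]])
  then show "lagrangian y f \<le> lagrangian y (\<lambda>w. sgn (field y w))" unfolding integral_gap[OF f f1] by simp
  assume "lagrangian y f = lagrangian y (\<lambda>w. sgn (field y w))"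
  then have "(LINT w|sphere_measure. norm (field y w) - field y w \<bullet> f w) = 0"
    unfolding integral_gap[OF f f1] by simp
  then have "AE w in sphere_measure. norm (field y w) - field y w \<bullet> f w = 0"
    using integral_nonneg_eq_0_iff_AE[OF _ gap_nonneg[OF f1]]
      integrable_norm_field integrable_inner_field[OF f f1] by auto
  then show "AE w in sphere_measure. f w = sgn (field y w)"
    using f1 field_neq_0[of y]
  proof eventually_elim
    case (elim w)
    \<comment> \<open>With zero deficit the weighted square vanishes, and its weight is positive
      since the field is nonzero at \<open>w\<close>.\<close>
    have "(norm (f w - sgn (field y w)))\<^sup>2 * norm (field y w) \<le> 0"
      using norm_diff_sgn_le[OF elim(2,3)] elim(1) by simp
    then show ?case using elim(3) by (simp add: mult_le_0_iff)
  qed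
qed

text \<open>The deficits are nonnegative with integrals tending to 0, hence tend to 0 almost
  everywhere along a subsequence; \<open>norm_diff_sgn_le\<close> turns this into convergence of the
  fields.\<close>

lemma maximizing_sequence:
  fixes g :: "nat \<Rightarrow> real^'n \<Rightarrow> 'b"
  assumes g [measurable]: "\<And>k. g k \<in> borel_measurable sphere_measure"
    and g1: "\<And>k. AE w in sphere_measure. norm (g k w) \<le> 1"
    and lim: "(\<lambda>k. lagrangian y (g k)) \<longlonglongrightarrow> lagrangian y (\<lambda>w. sgn (field y w))"
  obtains \<phi> :: "nat \<Rightarrow> nat" where "strict_mono \<phi>"
    "AE w in sphere_measure. (\<lambda>k. g (\<phi> k) w) \<longlonglongrightarrow> sgn (field y w)"
proof -
  let ?u = "\<lambda>k w. norm (field y w) - field y w \<bullet> g k w"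
  have I: "integrable sphere_measure (?u k)" for k
    using integrable_norm_field integrable_inner_field[OF g g1] by auto
  have "(LINT w|sphere_measure. norm (?u k w)) = (LINT w|sphere_measure. ?u k w)" for k
    using gap_nonneg[OF g1[of k], of y] by (intro integral_cong_AE) auto
  moreover have "(\<lambda>k. LINT w|sphere_measure. ?u k w) \<longlonglongrightarrow> 0"
    unfolding integral_gap[OF g g1] using tendsto_diff[OF tendsto_const[of "lagrangian y (\<lambda>w. sgn (field y w))"] lim] by simp
  ultimately have "(\<lambda>k. LINT w|sphere_measure. norm (?u k w)) \<longlonglongrightarrow> 0" by simp
  then obtain \<phi> :: "nat \<Rightarrow> nat" where \<phi>: "strict_mono \<phi>" "AE w in sphere_measure. (\<lambda>k. ?u (\<phi> k) w) \<longlonglongrightarrow> 0"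
    using tendsto_L1_AE_subseq[of sphere_measure ?u, OF I] by blast
  have "AE w in sphere_measure. \<forall>k. norm (g k w) \<le> 1" using g1 by (simp add: AE_all_countable)
  with \<phi>(2) field_neq_0[of y]
  have "AE w in sphere_measure. (\<lambda>k. g (\<phi> k) w) \<longlonglongrightarrow> sgn (field y w)"
  proof eventually_elim
    case (elim w)
    have "(\<lambda>k. (norm (g (\<phi> k) w - sgn (field y w)))\<^sup>2) \<longlonglongrightarrow> 0"
    proof (rule tendsto_sandwich[OF _ _ tendsto_const])
      show "\<forall>\<^sub>F k in sequentially. (norm (g (\<phi> k) w - sgn (field y w)))\<^sup>2 \<le> 2 / norm (field y w) * ?u (\<phi> k) w"
        using norm_diff_sgn_le[OF _ elim(2)] elim(2,3) by (intro always_eventually allI) (simp add: field_simps)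
      show "(\<lambda>k. 2 / norm (field y w) * ?u (\<phi> k) w) \<longlonglongrightarrow> 0"
        using tendsto_mult_right_zero[OF elim(1)] .
    qed simp
    then have "(\<lambda>k. sqrt ((norm (g (\<phi> k) w - sgn (field y w)))\<^sup>2)) \<longlonglongrightarrow> sqrt 0"
      by (rule tendsto_real_sqrt)
    then show ?case by (simp add: LIM_zero_iff tendsto_norm_zero_iff)
  qed
  with \<phi>(1) show thesis by (rule that)
qed

end

section \<open>The extremal map\<close>

lemma inner_join: "join a b \<bullet> join c d = a \<bullet> c + b * d"
proof -
  have "(\<Sum>i\<in>UNIV. join a b $ i * join c d $ i)
      = (\<Sum>j\<in>UNIV. join a b $ Inl j * join c d $ Inl j) + (\<Sum>k\<in>(UNIV :: 1 set). join a b $ Inr k * join c d $ Inr k)"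
    by (subst UNIV_Plus_UNIV[symmetric]) (simp add: sum.Plus o_def del: UNIV_Plus_UNIV)
  then show ?thesis by (simp add: inner_vec_def join_def)
qed

lemma inner_parts: "x \<bullet> y = init_part x \<bullet> init_part y + last_part x * last_part y"
  by (metis inner_join join_parts)

lemma inner_e0: "x \<bullet> e0 = init_part x \<bullet> first_unit"
  by (simp add: inner_parts e0_def)

lemma norm_e0: "norm e0 = 1"
  by (simp add: norm_eq_1 inner_e0) (simp add: e0_def first_unit_def inner_axis_axis)

lemma norm_parts: "(norm x)\<^sup>2 = (norm (init_part x))\<^sup>2 + (last_part x)\<^sup>2"
  unfolding power2_norm_eq_inner by (simp add: inner_parts power2_eq_square)

lemma bounded_linear_init_part: "bounded_linear init_part"
  unfolding linear_conv_bounded_linear[symmetric]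
  by (rule linearI) (simp_all add: init_part_def vec_eq_iff)

lemma bounded_linear_last_part: "bounded_linear last_part"
  unfolding linear_conv_bounded_linear[symmetric]
  by (rule linearI) (simp_all add: last_part_def)

lemma norm_init_part_le: "norm (init_part x) \<le> norm x"
proof (rule power2_le_imp_le)
  show "(norm (init_part x))\<^sup>2 \<le> (norm x)\<^sup>2" by (simp add: norm_parts[of x])
qed simp

lemma continuous_on_join: "continuous_on UNIV (\<lambda>(a :: real^'m, b). join a b)"
proof -
  have "continuous_on UNIV (\<lambda>p :: (real^'m) \<times> real. case i of Inl j \<Rightarrow> fst p $ j | Inr _ \<Rightarrow> snd p)"
    for i :: "'m + 1"
    by (cases i) (auto intro!: continuous_intros)
  then have "continuous_on UNIV (\<lambda>p :: (real^'m) \<times> real. (\<chi> i. case i of Inl j \<Rightarrow> fst p $ j | Inr _ \<Rightarrow> snd p) :: real^('m + 1))"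
    by (rule continuous_on_vec_lambda)
  then show ?thesis by (simp add: join_def case_prod_beta)
qed

section \<open>The extremal map as a Poisson integral of a unit field\<close>

text \<open>The kernel is an injective function of the distance to \<open>r v\<close>, and that
  distance, as \<open>r > 0\<close>, determines \<open>w \<bullet> v\<close>. A level set therefore
  lies in a single latitude.\<close>

lemma poisson_kernel_level:
  fixes v :: "real^'n"
  assumes n: "CARD('n) \<ge> 2" and v: "norm v = 1" and r: "0 < r" "r < 1"
  shows "AE w in sphere_measure. poisson_kernel (r *\<^sub>R v) w \<noteq> s"
proof (cases "\<exists>w0. norm w0 = 1 \<and> poisson_kernel (r *\<^sub>R v) w0 = s")
  case False
  show ?thesis using AE_sphere_norm by eventually_elim (use False in auto)
next
  case True
  then obtain w0 where w0: "norm w0 = 1" "poisson_kernel (r *\<^sub>R v) w0 = s" by auto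
  have dist: "(norm (r *\<^sub>R v - w))\<^sup>2 = r\<^sup>2 + 1 - 2 * r * (w \<bullet> v)" if "norm w = 1" for w
  proof -
    have "v \<bullet> v = 1" "w \<bullet> w = 1" using v that by (simp_all add: dot_square_norm)
    then show ?thesis
      unfolding power2_norm_eq_inner
      by (simp add: inner_diff_left inner_diff_right inner_commute[of v w] power2_eq_square algebra_simps)
  qed
  show ?thesis
    using AE_sphere_inner_neq[OF n v, of "w0 \<bullet> v"] AE_sphere_norm
  proof eventually_elim
    case (elim w)
    have pos: "norm (r *\<^sub>R v - u) > 0" if "norm u = 1" for u
      using that v r by (auto simp: norm_eq_zero)
    show ?case
    proof
      assume "poisson_kernel (r *\<^sub>R v) w = s"
      then have "(1 - r\<^sup>2) / norm (r *\<^sub>R v - w) ^ CARD('n) = (1 - r\<^sup>2) / norm (r *\<^sub>R v - w0) ^ CARD('n)"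
        using w0(2) v r by (simp add: poisson_kernel_def)
      moreover have "1 - r\<^sup>2 \<noteq> 0" using r by (simp add: abs_square_less_1 less_imp_neq[symmetric] power_less_one_iff)
      ultimately have "norm (r *\<^sub>R v - w) ^ CARD('n) = norm (r *\<^sub>R v - w0) ^ CARD('n)"
        using pos[OF elim(2)] pos[OF w0(1)] by (simp add: frac_eq_eq)
      then have "norm (r *\<^sub>R v - w) = norm (r *\<^sub>R v - w0)"
        by (rule power_eq_imp_eq_base) auto
      then have "(norm (r *\<^sub>R v - w))\<^sup>2 = (norm (r *\<^sub>R v - w0))\<^sup>2" by simp
      then have "r\<^sup>2 + 1 - 2 * r * (w \<bullet> v) = r\<^sup>2 + 1 - 2 * r * (w0 \<bullet> v)"
        unfolding dist[OF elim(2)] dist[OF w0(1)] .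
      then have "w \<bullet> v = w0 \<bullet> v" using r by simp
      then show False using elim(1) by simp
    qed
  qed
qed

lemma norm_north: "norm north = 1"
  by (simp add: north_def norm_axis_1)

lemma extremal_problem_poisson:
  fixes p :: "real^('m::{finite,linorder} + 1)"
  assumes n: "CARD('n::{finite,linorder}) \<ge> 2" and r: "0 < r" "r < 1" and p: "norm p < 1"
  shows "extremal_problem (poisson_kernel (r *\<^sub>R (north :: real^'n::{finite,linorder}))) e0 p (1 / (1 - r) ^ CARD('n))"
proof
  show "AE w in sphere_measure. \<bar>poisson_kernel (r *\<^sub>R (north :: real^'n::_)) w\<bar> \<le> 1 / (1 - r) ^ CARD('n)"
    using AE_sphere_norm
  proof eventually_elim
    case (elim w)
    then show ?case using poisson_kernel_bound[of "r *\<^sub>R north" w] r by (simp add: norm_north)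
  qed
  show "AE w in sphere_measure. poisson_kernel (r *\<^sub>R (north :: real^'n::_)) w \<noteq> s" for s
    by (rule poisson_kernel_level[OF n norm_north r])
qed (auto simp: norm_e0 p)

lemma poisson_bounded_linear:
  fixes f :: "real^'n \<Rightarrow> 'b::{banach,second_countable_topology}" and h :: "'b \<Rightarrow> 'c::{banach,second_countable_topology}"
  assumes h: "bounded_linear h" and f: "f \<in> borel_measurable sphere_measure"
    "AE w in sphere_measure. norm (f w) \<le> B" "norm x < 1"
  shows "poisson (\<lambda>w. h (f w)) x = h (poisson f x)"
proof -
  interpret h: bounded_linear h by (rule h)
  show ?thesis
    unfolding poisson_eq
    using integral_bounded_linear[OF h integrable_poisson[OF f]] by (simp add: h.scaleR)
qed

lemma poisson_cong_AE:
  fixes f g :: "real^'n \<Rightarrow> 'b::{banach,second_countable_topology}"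
  assumes [measurable]: "f \<in> borel_measurable sphere_measure" "g \<in> borel_measurable sphere_measure"
    and "AE w in sphere_measure. f w = g w"
  shows "poisson f x = poisson g x"
  unfolding poisson_eq by (rule integral_cong_AE) (use assms(3) in auto)

text \<open>Every admissible \<open>u\<close> lifts to a field of norm 1 almost everywhere by
  appending \<open>sg * sqrt (1 - |u|^2)\<close>. The last component of the lift may have too large
  a mean in absolute value, but the multiplier has the sign for which this only increases the
  Lagrangian. Hence \<open>L u + y \<bullet> p\<close> is at most the Lagrangian of the lift, thus
  at most that of \<open>f\<close>, which is \<open>L (init_part f) + y \<bullet> p\<close>.\<close>

lemma F_ext_eq_poisson:
  fixes p y :: "real^('m::{finite,linorder} + 1)" and r :: real
  defines "f \<equiv> \<lambda>w :: real^'n::{finite,linorder}. sgn (poisson_kernel (r *\<^sub>R north) w *\<^sub>R e0 + y)"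
  assumes n: "CARD('n) \<ge> 2" and r: "0 < r" "r < 1" and p: "norm p < 1"
    and mean: "(LINT w|sphere_measure. f w) = p" and x: "norm x < 1"
  shows "F_ext p r x = poisson f x"
proof -
  interpret extremal_problem "poisson_kernel (r *\<^sub>R (north :: real^'n::_))" e0 p "1 / (1 - r) ^ CARD('n)"
    by (rule extremal_problem_poisson[OF n r p])
  have f_eq: "f = (\<lambda>w. sgn (field y w))" by (simp add: f_def field_def)
  have fm [measurable]: "f \<in> borel_measurable sphere_measure" by (simp add: f_eq)
  have f1: "AE w in sphere_measure. norm (f w) \<le> 1" unfolding f_eq by (rule norm_sgn_le)
  have f_unit: "AE w in sphere_measure. norm (f w) = 1"
    using field_neq_0[of y] by eventually_elim (simp add: f_eq norm_sgn)
  note If = integrable_unit[OF fm f1]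
  note [measurable] = borel_measurable_continuous_onI[OF linear_continuous_on[OF bounded_linear_init_part]]
    borel_measurable_continuous_onI[OF linear_continuous_on[OF bounded_linear_last_part]]
  define a b where "a = init_part p" and "b = last_part p"
  \<comment> \<open>For \<open>b < 0\<close> the class uses \<open>\<bar>b\<bar>\<close> and \<open>V_ext\<close> changes sign; \<open>sg\<close> treats both cases at once.\<close>
  define sg :: real where "sg = (if b \<ge> 0 then 1 else - 1)"
  have sgb: "sg * b = \<bar>b\<bar>" and sg2: "sg * sg = 1" by (auto simp: sg_def)
  have Iinit: "(LINT w|sphere_measure. init_part (f w)) = a"
    using integral_bounded_linear[OF bounded_linear_init_part If] mean by (simp add: a_def)
  have Ilast: "(LINT w|sphere_measure. last_part (f w)) = b"
    using integral_bounded_linear[OF bounded_linear_last_part If] mean by (simp add: b_def)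
  have Il: "integrable sphere_measure (\<lambda>w. last_part (f w))"
    by (rule integrable_bounded_linear[OF bounded_linear_last_part If])
  define \<mu> where "\<mu> = last_part y"
  \<comment> \<open>\<open>e0\<close> has last coordinate 0, so the kernel drops out of the
    numerator.\<close>
  have last_f: "last_part (f w) = \<mu> / norm (field y w)" for w
  proof -
    have "last_part (field y w) = \<mu>"
      unfolding field_def by (simp add: last_part_def \<mu>_def e0_def join_def)
    then show ?thesis by (simp add: f_eq sgn_div_norm last_part_def divide_inverse)
  qed
  have emeas: "emeasure (sphere_measure :: (real^'n::_) measure) (space sphere_measure) \<noteq> 0"
    by (simp add: space_sphere_measure emeasure_sphere_measure_sphere)
  \<comment> \<open>The last component of \<open>f\<close> has the sign of \<open>\<mu>\<close> and
    its mean is \<open>b\<close>. For \<open>b \<ge> 0\<close> a negative \<open>\<mu>\<close> would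
    make that mean strictly negative; for \<open>b < 0\<close> a positive \<open>\<mu>\<close> would
    make it nonnegative.\<close>
  have sgmu: "0 \<le> sg * \<mu>"
  proof (cases "b \<ge> 0")
    case True
    have "0 \<le> \<mu>"
    proof (rule ccontr)
      assume "\<not> 0 \<le> \<mu>"
      have "(LINT w|sphere_measure. last_part (f w)) < (LINT w|(sphere_measure :: (real^'n::_) measure). 0)"
      proof (rule sphere.integral_less_AE_space[OF Il _ _ emeas])
        show "AE w in sphere_measure. last_part (f w) < 0"
          using field_neq_0[of y] by eventually_elim (use \<open>\<not> 0 \<le> \<mu>\<close> in \<open>simp add: last_f divide_neg_pos\<close>)
      qed simp
      then show False using True Ilast by simp
    qed
    then show ?thesis using True by (simp add: sg_def)
  next
    case False
    have "\<mu> \<le> 0"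
    proof (rule ccontr)
      assume "\<not> \<mu> \<le> 0"
      have "0 \<le> (LINT w|sphere_measure. last_part (f w))"
        by (intro Bochner_Integration.integral_nonneg) (use \<open>\<not> \<mu> \<le> 0\<close> in \<open>simp add: last_f\<close>)
      then show False using False Ilast by simp
    qed
    then show ?thesis using False by (simp add: sg_def)
  qed
  have last_sqrt: "AE w in sphere_measure. sqrt (1 - (norm (init_part (f w)))\<^sup>2) = sg * last_part (f w)"
    using f_unit
  proof eventually_elim
    case (elim w)
    have "1 - (norm (init_part (f w)))\<^sup>2 = (last_part (f w))\<^sup>2"
      using norm_parts[of "f w"] elim by simp
    moreover have "\<bar>last_part (f w)\<bar> = sg * last_part (f w)"
    proof -
      have "0 \<le> sg * last_part (f w)" using sgmu by (simp add: last_f divide_nonneg_nonneg)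
      then show ?thesis by (auto simp: sg_def split: if_splits)
    qed
    ultimately show ?case by simp
  qed
  let ?u = "\<lambda>w. init_part (f w)"
  have u_adm: "?u \<in> admissible a \<bar>b\<bar>"
  proof -
    have "AE w in sphere_measure. norm (?u w) \<le> 1"
      using f1 by eventually_elim (rule order_trans[OF norm_init_part_le])
    moreover have "(LINT w|sphere_measure. sqrt (1 - (norm (?u w))\<^sup>2)) = (LINT w|sphere_measure. sg * last_part (f w))"
      by (rule integral_cong_AE) (use last_sqrt in auto)
    then have "(LINT w|sphere_measure. sqrt (1 - (norm (?u w))\<^sup>2)) = \<bar>b\<bar>"
      by (simp add: Ilast sgb)
    ultimately show ?thesis using Iinit by (simp add: admissible_def)
  qed
  have L_eq: "L_functional r u = (LINT w|sphere_measure. poisson_kernel (r *\<^sub>R (north :: real^'n::_)) w * (u w \<bullet> first_unit))"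
    for u :: "real^'n::_ \<Rightarrow> real^'m::_"
    using r by (simp add: L_functional_def poisson_kernel_def norm_north)
  \<comment> \<open>The lift to a unit field, on the side of the equator given by the sign of
    \<open>b\<close>.\<close>
  let ?l = "\<lambda>u w. join (u w) (sg * sqrt (1 - (norm (u w))\<^sup>2)) :: real^('m + 1)"
  have lift: "?l u \<in> borel_measurable sphere_measure" "AE w in sphere_measure. norm (?l u w) \<le> 1"
      "L_functional r u + y \<bullet> p \<le> lagrangian y (?l u)"
    if u: "u \<in> admissible a \<bar>b\<bar>" for u :: "real^'n::_ \<Rightarrow> real^'m::_"
  proof -
    have um [measurable]: "u \<in> borel_measurable sphere_measure"
      and u1: "AE w in sphere_measure. norm (u w) \<le> 1"
      and ua: "(LINT w|sphere_measure. u w) = a"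
      and ub: "\<bar>b\<bar> \<le> (LINT w|sphere_measure. sqrt (1 - (norm (u w))\<^sup>2))"
      using u by (auto simp: admissible_def)
    have jm: "(\<lambda>(a, b). join a b) \<in> borel_measurable (borel \<Otimes>\<^sub>M borel)"
      using borel_measurable_continuous_onI[OF continuous_on_join] by (simp add: borel_prod)
    have "(\<lambda>w. (u w, sg * sqrt (1 - (norm (u w))\<^sup>2))) \<in> measurable sphere_measure (borel \<Otimes>\<^sub>M borel)"
      by measurable
    from measurable_compose[OF this jm] show lm: "?l u \<in> borel_measurable sphere_measure" by simp
    show l1: "AE w in sphere_measure. norm (?l u w) \<le> 1"
      using u1
    proof eventually_elim
      case (elim w)
      then have "(norm (?l u w))\<^sup>2 = 1"
        using sg2 by (simp add: norm_parts power_mult_distrib power_le_one power2_eq_square[of sg])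
      then show ?case using power2_le_imp_le[of "norm (?l u w)" 1] by simp
    qed
    note Il = integrable_unit[OF lm l1]
    have "init_part (LINT w|sphere_measure. ?l u w) = a"
      using integral_bounded_linear[OF bounded_linear_init_part Il] ua by simp
    moreover have "last_part (LINT w|sphere_measure. ?l u w) = sg * (LINT w|sphere_measure. sqrt (1 - (norm (u w))\<^sup>2))"
      using integral_bounded_linear[OF bounded_linear_last_part Il] by simp
    ultimately have "y \<bullet> (LINT w|sphere_measure. ?l u w)
        = init_part y \<bullet> a + sg * \<mu> * (LINT w|sphere_measure. sqrt (1 - (norm (u w))\<^sup>2))"
      by (simp add: inner_parts[of y] \<mu>_def)
    \<comment> \<open>The slack of the inequality constraint, multiplied by a nonnegative
      multiplier.\<close>
    moreover have "sg * \<mu> * \<bar>b\<bar> \<le> sg * \<mu> * (LINT w|sphere_measure. sqrt (1 - (norm (u w))\<^sup>2))"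
      by (rule mult_left_mono[OF ub sgmu])
    moreover have "sg * \<mu> * \<bar>b\<bar> = \<mu> * b"
      using sg2 by (simp add: sgb[symmetric] mult.assoc mult.left_commute)
    moreover have "y \<bullet> p = init_part y \<bullet> a + \<mu> * b" by (simp add: inner_parts[of y] a_def b_def \<mu>_def)
    ultimately show "L_functional r u + y \<bullet> p \<le> lagrangian y (?l u)"
      by (simp add: lagrangian_def L_eq inner_e0)
  qed
  have lag_f: "lagrangian y f = L_functional r ?u + y \<bullet> p"
    by (simp add: lagrangian_def L_eq inner_e0 mean)
  have u_max: "L_functional r u \<le> L_functional r ?u" if "u \<in> admissible a \<bar>b\<bar>" for u :: "real^'n::_ \<Rightarrow> real^'m::_"
    using lift(3)[OF that] lagrangian_le[OF lift(1,2)[OF that], of y] lag_f by (simp add: f_eq)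
  \<comment> \<open>\<open>X\<close> is the representative picked by \<open>arg_max_on\<close>. That
    \<open>?u\<close> attains the maximum makes this choice meaningful.\<close>
  define X where "X = (extremal a \<bar>b\<bar> r :: real^'n::_ \<Rightarrow> real^'m::_)"
  have X: "X \<in> admissible a \<bar>b\<bar> \<and> L_functional r ?u \<le> L_functional r X"
    unfolding X_def extremal_def arg_max_on_def
  proof (rule arg_maxI[where x = ?u and P = "\<lambda>u. u \<in> admissible a \<bar>b\<bar>"
        and Q = "\<lambda>X. X \<in> admissible a \<bar>b\<bar> \<and> L_functional r ?u \<le> L_functional r X"])
    show "?u \<in> admissible a \<bar>b\<bar>" by (rule u_adm)
    show "\<not> L_functional r ?u < L_functional r u" if "u \<in> admissible a \<bar>b\<bar>" for u :: "real^'n::_ \<Rightarrow> real^'m::_"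
      using u_max[OF that] by simp
    show "u \<in> admissible a \<bar>b\<bar> \<and> L_functional r ?u \<le> L_functional r u"
      if "u \<in> admissible a \<bar>b\<bar>" "\<forall>v :: real^'n::_ \<Rightarrow> real^'m::_. v \<in> admissible a \<bar>b\<bar> \<longrightarrow> \<not> L_functional r u < L_functional r v"
      for u :: "real^'n::_ \<Rightarrow> real^'m::_"
      using that u_adm by (auto simp: not_less)
  qed
  have XA: "X \<in> admissible a \<bar>b\<bar>" using X by blast
  have Xm [measurable]: "X \<in> borel_measurable sphere_measure" using XA by (simp add: admissible_def)
  \<comment> \<open>\<open>X\<close> does at least as well as \<open>?u\<close>, so all inequalities
    in the chain are equalities, and uniqueness identifies the lift of \<open>X\<close> with
    \<open>f\<close> almost everywhere.\<close>
  have "lagrangian y (?l X) = lagrangian y f"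
    using lift(3)[OF XA] lagrangian_le[OF lift(1,2)[OF XA], of y] lag_f X by (simp add: f_eq)
  then have XAE: "AE w in sphere_measure. ?l X w = f w"
    using lagrangian_unique[OF lift(1,2)[OF XA], of y] by (simp add: f_eq)
  have X1: "AE w in sphere_measure. X w = init_part (f w)"
    using XAE by eventually_elim (metis init_part_join)
  have X2: "AE w in sphere_measure. sqrt (1 - (norm (X w))\<^sup>2) = sg * last_part (f w)"
    using X1 last_sqrt by eventually_elim simp
  have "poisson X x = init_part (poisson f x)"
    using poisson_cong_AE[OF _ _ X1, of x] poisson_bounded_linear[OF bounded_linear_init_part fm f1 x] by simp
  moreover have "poisson (\<lambda>w. sqrt (1 - (norm (X w))\<^sup>2)) x = sg * last_part (poisson f x)"
  proof -
    have "bounded_linear (\<lambda>z :: real^('m + 1). sg * last_part z)"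
      by (rule bounded_linear_const_mult[OF bounded_linear_last_part])
    from poisson_bounded_linear[OF this fm f1 x] show ?thesis
      using poisson_cong_AE[OF _ _ X2, of x] by simp
  qed
  moreover have "U_ext a b r x = poisson X x"
    by (simp add: U_ext_def X_def abs_if)
  moreover have "V_ext a b r x = sg * poisson (\<lambda>w. sqrt (1 - (norm (X w))\<^sup>2)) x"
    by (simp add: V_ext_def X_def abs_if sg_def)
  ultimately have "F_ext p r x = join (init_part (poisson f x)) (sg * sg * last_part (poisson f x))"
    by (simp add: F_ext_def a_def[symmetric] b_def[symmetric] mult.assoc)
  then show ?thesis by (simp add: sg2 join_parts)
qed

lemma F_ext_attained:
  fixes p :: "real^('m::{finite,linorder} + 1)"
  assumes n: "CARD('n::{finite,linorder}) \<ge> 2" and r: "0 < r" "r < 1" and p: "norm p < 1"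
  obtains y where
    "(LINT w|sphere_measure. sgn (poisson_kernel (r *\<^sub>R (north :: real^'n::{finite,linorder})) w *\<^sub>R e0 + y)) = p"
    "\<And>x :: real^'n::{finite,linorder}. norm x < 1 \<Longrightarrow>
      F_ext p r x = poisson (\<lambda>w. sgn (poisson_kernel (r *\<^sub>R north) w *\<^sub>R e0 + y)) x"
proof -
  interpret extremal_problem "poisson_kernel (r *\<^sub>R (north :: real^'n::_))" e0 p "1 / (1 - r) ^ CARD('n)"
    by (rule extremal_problem_poisson[OF n r p])
  obtain y where y: "(LINT w|sphere_measure. sgn (field y w)) = p" by (rule mean_sgn_field)
  show thesis
  proof (rule that)
    show m: "(LINT w|sphere_measure. sgn (poisson_kernel (r *\<^sub>R (north :: real^'n::_)) w *\<^sub>R e0 + y)) = p"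
      using y by (simp add: field_def)
    show "F_ext p r x = poisson (\<lambda>w. sgn (poisson_kernel (r *\<^sub>R north) w *\<^sub>R e0 + y)) x"
      if "norm x < 1" for x :: "real^'n::_"
      by (rule F_ext_eq_poisson[OF n r p m that])
  qed
qed

lemma poisson_inner:
  fixes f :: "real^'n \<Rightarrow> 'b::euclidean_space"
  assumes "f \<in> borel_measurable sphere_measure" "AE w in sphere_measure. norm (f w) \<le> B" "norm x < 1"
  shows "poisson f x \<bullet> e = (LINT w|sphere_measure. poisson_kernel x w * (f w \<bullet> e))"
  using poisson_bounded_linear[OF bounded_linear_inner_left assms, of e] by (simp add: poisson_eq)

section \<open>The sharp inequality\<close>

text \<open>Isolates what is used of a harmonic map into the ball once the representation is known.
  In this form invariance under rotations of domain and target calls for no derivatives.\<close>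

definition poisson_contraction :: "(real^'n \<Rightarrow> 'b::euclidean_space) \<Rightarrow> bool" where
  "poisson_contraction G \<longleftrightarrow> continuous_on (ball 0 1) G \<and> (\<forall>x. norm x < 1 \<longrightarrow> norm (G x) < 1) \<and>
    (\<forall>\<rho> x. 0 \<le> \<rho> \<longrightarrow> \<rho> < 1 \<longrightarrow> norm x < 1 \<longrightarrow> poisson (\<lambda>w. G (\<rho> *\<^sub>R w)) x = G (\<rho> *\<^sub>R x))"

lemma
  assumes "poisson_contraction G" "0 \<le> \<rho>" "\<rho> < 1"
  shows poisson_contraction_measurable: "(\<lambda>w. G (\<rho> *\<^sub>R w)) \<in> borel_measurable sphere_measure"
    and poisson_contraction_bound: "AE w in sphere_measure. norm (G (\<rho> *\<^sub>R w)) \<le> 1"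
    and poisson_contraction_mean: "(LINT w|sphere_measure. G (\<rho> *\<^sub>R w)) = G 0"
proof -
  have lt: "norm (\<rho> *\<^sub>R w) < 1" if "norm w = 1" for w :: "real^'n"
    using norm_scaleR_less_one[of \<rho> w] assms that by simp
  have c: "continuous_on (ball 0 1) G" and b: "\<And>x. norm x < 1 \<Longrightarrow> norm (G x) < 1"
    and rep: "poisson (\<lambda>w. G (\<rho> *\<^sub>R w)) 0 = G (\<rho> *\<^sub>R 0)"
    using assms by (auto simp: poisson_contraction_def)
  have "continuous_on (sphere 0 1) (\<lambda>w. G (\<rho> *\<^sub>R w))"
    by (rule continuous_on_compose2[OF c]) (use assms(2,3) in \<open>auto intro!: continuous_intros\<close>)
  then show m: "(\<lambda>w. G (\<rho> *\<^sub>R w)) \<in> borel_measurable sphere_measure"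
    by (rule continuous_on_sphere_measurable)
  show "AE w in sphere_measure. norm (G (\<rho> *\<^sub>R w)) \<le> 1"
    using AE_sphere_norm by eventually_elim (use lt b less_imp_le in blast)
  show "(LINT w|sphere_measure. G (\<rho> *\<^sub>R w)) = G 0"
    using rep by (simp add: poisson_0[OF m])
qed

text \<open>The fields \<open>w \<mapsto> G (\<rho> w)\<close> all have mean \<open>G 0\<close>, so
  they compete in one problem with a fixed multiplier; their Lagrangian is
  \<open>G (\<rho> r N) \<bullet> e0\<close> plus a constant, where \<open>N\<close> is
  \<open>north\<close>.\<close>

lemma
  fixes G :: "real^'n::{finite,linorder} \<Rightarrow> real^('m::{finite,linorder} + 1)"
  assumes n: "CARD('n) \<ge> 2" and r: "0 < r" "r < 1"
    and G: "poisson_contraction G"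
  shows schwarz_pick_le: "G (r *\<^sub>R north) \<bullet> e0 \<le> F_ext (G 0) r (r *\<^sub>R (north :: real^'n::{finite,linorder})) \<bullet> e0"
    and schwarz_pick_unique: "G (r *\<^sub>R north) \<bullet> e0 = F_ext (G 0) r (r *\<^sub>R (north :: real^'n::{finite,linorder})) \<bullet> e0
      \<Longrightarrow> norm x < 1 \<Longrightarrow> G x = F_ext (G 0) r x"
    and schwarz_pick_centre: "G 0 \<bullet> e0 < F_ext (G 0) r (r *\<^sub>R (north :: real^'n::{finite,linorder})) \<bullet> e0"
proof -
  let ?N = "north :: real^'n::_" and ?p = "G 0"
  have cont: "continuous_on (ball 0 1) G" and G1: "\<And>x. norm x < 1 \<Longrightarrow> norm (G x) < 1"
    and rep: "\<And>\<rho> x. 0 \<le> \<rho> \<Longrightarrow> \<rho> < 1 \<Longrightarrow> norm x < 1 \<Longrightarrow> poisson (\<lambda>w. G (\<rho> *\<^sub>R w)) x = G (\<rho> *\<^sub>R x)"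
    using G by (auto simp: poisson_contraction_def)
  have p: "norm ?p < 1" using G1[of 0] by simp
  interpret extremal_problem "poisson_kernel (r *\<^sub>R ?N)" e0 ?p "1 / (1 - r) ^ CARD('n)"
    by (rule extremal_problem_poisson[OF n r p])
  obtain y where mean': "(LINT w|sphere_measure. sgn (poisson_kernel (r *\<^sub>R ?N) w *\<^sub>R e0 + y)) = ?p"
    and Fe': "\<And>x :: real^'n::_. norm x < 1 \<Longrightarrow>
      F_ext ?p r x = poisson (\<lambda>w. sgn (poisson_kernel (r *\<^sub>R ?N) w *\<^sub>R e0 + y)) x"
    using F_ext_attained[OF n r p] by blast
  let ?f = "\<lambda>w. sgn (field y w)"
  have mean: "(LINT w|sphere_measure. ?f w) = ?p" using mean' by (simp add: field_def)
  have Fe: "F_ext ?p r x = poisson ?f x" if "norm x < 1" for x :: "real^'n::_"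
    using Fe'[OF that] by (simp add: field_def)
  have rN: "norm (r *\<^sub>R ?N) < 1" using r by (simp add: norm_north)
  define M where "M = F_ext ?p r (r *\<^sub>R ?N) \<bullet> e0"
  have M: "M = (LINT w|sphere_measure. poisson_kernel (r *\<^sub>R ?N) w * (?f w \<bullet> e0))"
    unfolding M_def Fe[OF rN] by (rule poisson_inner[OF _ norm_sgn_le rN]) simp
  then have lag_f: "lagrangian y ?f = M + y \<bullet> ?p" by (simp add: lagrangian_def mean)
  define \<rho> where "\<rho> k = 1 - inverse (real (Suc k))" for k
  have \<rho>: "0 \<le> \<rho> k" "\<rho> k < 1" for k by (auto simp: \<rho>_def inverse_le_1_iff)
  have \<rho>lim: "\<rho> \<longlonglongrightarrow> 1"
    unfolding \<rho>_def using tendsto_diff[OF tendsto_const[of 1] LIMSEQ_inverse_real_of_nat] by simp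
  define g where "g k w = G (\<rho> k *\<^sub>R w)" for k and w :: "real^'n::_"
  have gm: "g k \<in> borel_measurable sphere_measure" and g1: "AE w in sphere_measure. norm (g k w) \<le> 1"
    and gmean: "(LINT w|sphere_measure. g k w) = ?p" for k
    unfolding g_def by (rule poisson_contraction_measurable[OF G \<rho>] poisson_contraction_bound[OF G \<rho>]
        poisson_contraction_mean[OF G \<rho>])+
  have glim: "(\<lambda>k. G (\<rho> k *\<^sub>R x)) \<longlonglongrightarrow> G x" if x: "norm x < 1" for x
  proof -
    have "isCont G x" using cont x by (simp add: continuous_on_eq_continuous_at)
    moreover have "(\<lambda>k. \<rho> k *\<^sub>R x) \<longlonglongrightarrow> x" using tendsto_scaleR[OF \<rho>lim tendsto_const[of x]] by simp
    ultimately show ?thesis by (rule isCont_tendsto_compose)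
  qed
  have lag_g: "lagrangian y (g k) = G (\<rho> k *\<^sub>R (r *\<^sub>R ?N)) \<bullet> e0 + y \<bullet> ?p" for k
  proof -
    have "poisson (g k) (r *\<^sub>R ?N) = G (\<rho> k *\<^sub>R (r *\<^sub>R ?N))"
      unfolding g_def by (rule rep[OF \<rho> rN])
    then show ?thesis
      using poisson_inner[OF gm g1 rN, of k e0] by (simp add: lagrangian_def gmean)
  qed
  have lag_lim: "(\<lambda>k. lagrangian y (g k)) \<longlonglongrightarrow> G (r *\<^sub>R ?N) \<bullet> e0 + y \<bullet> ?p"
    unfolding lag_g by (intro tendsto_intros glim rN)
  have "lagrangian y (g k) \<le> M + y \<bullet> ?p" for k
    using lagrangian_le[OF gm g1, of y k] lag_f by simp
  then have "G (r *\<^sub>R ?N) \<bullet> e0 + y \<bullet> ?p \<le> M + y \<bullet> ?p"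
    by (intro LIMSEQ_le_const2[OF lag_lim]) auto
  then show "G (r *\<^sub>R ?N) \<bullet> e0 \<le> F_ext ?p r (r *\<^sub>R ?N) \<bullet> e0" by (simp add: M_def)
  show "G x = F_ext ?p r x" if eq: "G (r *\<^sub>R ?N) \<bullet> e0 = F_ext ?p r (r *\<^sub>R ?N) \<bullet> e0" and x: "norm x < 1"
  proof -
    have "(\<lambda>k. lagrangian y (g k)) \<longlonglongrightarrow> lagrangian y ?f"
      using lag_lim eq lag_f by (simp add: M_def)
    then obtain \<phi> :: "nat \<Rightarrow> nat" where \<phi>: "strict_mono \<phi>"
      "AE w in sphere_measure. (\<lambda>k. g (\<phi> k) w) \<longlonglongrightarrow> ?f w"
      using maximizing_sequence[of g y, OF gm g1] by blast
    have "(\<lambda>k. LINT w|sphere_measure. poisson_kernel x w *\<^sub>R g (\<phi> k) w)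
        \<longlonglongrightarrow> (LINT w|sphere_measure. poisson_kernel x w *\<^sub>R ?f w)"
    proof (rule integral_dominated_convergence[where w="\<lambda>_. 1 / (1 - norm x) ^ CARD('n)"])
      show "AE w in sphere_measure. (\<lambda>k. poisson_kernel x w *\<^sub>R g (\<phi> k) w) \<longlonglongrightarrow> poisson_kernel x w *\<^sub>R ?f w"
        using \<phi>(2) by eventually_elim (intro tendsto_intros)
      show "AE w in sphere_measure. norm (poisson_kernel x w *\<^sub>R g (\<phi> k) w) \<le> 1 / (1 - norm x) ^ CARD('n)" for k
        using AE_sphere_norm g1[of "\<phi> k"]
      proof eventually_elim
        case (elim w)
        have "\<bar>poisson_kernel x w\<bar> * norm (g (\<phi> k) w) \<le> 1 / (1 - norm x) ^ CARD('n) * 1"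
          using elim x by (intro mult_mono poisson_kernel_bound) auto
        then show ?case by simp
      qed
      show "(\<lambda>w. poisson_kernel x w *\<^sub>R g (\<phi> k) w) \<in> borel_measurable sphere_measure" for k
        using gm by (intro borel_measurable_scaleR poisson_kernel_measurable)
    qed auto
    then have "(\<lambda>k. poisson (g (\<phi> k)) x) \<longlonglongrightarrow> F_ext ?p r x" unfolding Fe[OF x] poisson_eq .
    moreover have "poisson (g k) x = G (\<rho> k *\<^sub>R x)" for k
      unfolding g_def by (rule rep[OF \<rho> x])
    ultimately have "(\<lambda>k. G (\<rho> (\<phi> k) *\<^sub>R x)) \<longlonglongrightarrow> F_ext ?p r x" by simp
    \<comment> \<open>A subsequence suffices, because continuity at \<open>x\<close> already fixes
      the limit.\<close>
    moreover have "(\<lambda>k. G (\<rho> (\<phi> k) *\<^sub>R x)) \<longlonglongrightarrow> G x"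
      using LIMSEQ_subseq_LIMSEQ[OF glim[OF x] \<phi>(1)] by (simp add: o_def)
    ultimately show ?thesis by (rule LIMSEQ_unique[symmetric])
  qed
  \<comment> \<open>The constant \<open>?p\<close> is a competitor, but not a unit field.\<close>
  show "?p \<bullet> e0 < F_ext ?p r (r *\<^sub>R ?N) \<bullet> e0"
  proof -
    have c1: "AE w in (sphere_measure :: (real^'n::_) measure). norm ?p \<le> 1" using p by simp
    have "(LINT w|sphere_measure. poisson_kernel (r *\<^sub>R ?N) w) = 1"
      using poisson_one[OF rN] by (simp add: poisson_eq)
    then have lag_c: "lagrangian y (\<lambda>_. ?p) = ?p \<bullet> e0 + y \<bullet> ?p"
      by (simp add: lagrangian_def space_sphere_measure)
    have "lagrangian y (\<lambda>_. ?p) \<noteq> lagrangian y ?f"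
    proof
      assume "lagrangian y (\<lambda>_. ?p) = lagrangian y ?f"
      then have "AE w in sphere_measure. ?p = ?f w"
        using lagrangian_unique[OF _ c1, of y] by simp
      then have "AE w in (sphere_measure :: (real^'n::_) measure). False"
        using field_neq_0[of y]
      proof eventually_elim
        case (elim w)
        then have "norm ?p = 1" by (simp add: norm_sgn)
        then show ?case using p by simp
      qed
      \<comment> \<open>A property false almost everywhere would make the total mass 1 equal to
        0.\<close>
      then have "(LINT w|(sphere_measure :: (real^'n::_) measure). 1 :: real) = (LINT w|(sphere_measure :: (real^'n::_) measure). 0)"
        by (intro integral_cong_AE) auto
      then show False by (simp add: space_sphere_measure)
    qed
    moreover have "lagrangian y (\<lambda>_. ?p) \<le> lagrangian y ?f"
      using lagrangian_le[OF _ c1, of y] by simp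
    ultimately show ?thesis unfolding lag_f lag_c M_def by simp
  qed
qed

text \<open>A strong maximum principle: the kernel is positive, so a Poisson integral equal to
  \<open>M\<close> at one point forces \<open>h = M\<close> almost everywhere, which the mean
  excludes.\<close>

lemma poisson_less:
  fixes h :: "real^'n \<Rightarrow> real"
  assumes h [measurable]: "h \<in> borel_measurable sphere_measure"
    and B: "AE w in sphere_measure. \<bar>h w\<bar> \<le> B" and le: "AE w in sphere_measure. h w \<le> M"
    and mean: "(LINT w|sphere_measure. h w) < M" and x: "norm x < 1"
  shows "poisson h x < M"
proof -
  have Bn: "AE w in sphere_measure. norm (M - h w) \<le> \<bar>M\<bar> + B"
    using B by eventually_elim auto
  have I: "integrable sphere_measure (\<lambda>w. poisson_kernel x w * (M - h w))"
    using integrable_poisson[OF _ Bn x] by simp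
  have I1: "integrable sphere_measure (\<lambda>w. poisson_kernel x w * M)"
    using integrable_poisson[of "\<lambda>_. M" "\<bar>M\<bar>" x] x by simp
  have Ih: "integrable sphere_measure (\<lambda>w. poisson_kernel x w * h w)"
    using integrable_poisson[OF h _ x, of B] B by simp
  have nn: "AE w in sphere_measure. 0 \<le> poisson_kernel x w * (M - h w)"
    using le AE_sphere_norm
  proof eventually_elim
    case (elim w)
    then show ?case using poisson_kernel_pos[OF x, of w] by simp
  qed
  have one: "(LINT w|sphere_measure. poisson_kernel x w) = 1"
    using poisson_one[OF x] by (simp add: poisson_eq)
  have eq: "(LINT w|sphere_measure. poisson_kernel x w * (M - h w)) = M - poisson h x"
    using I1 Ih by (simp add: right_diff_distrib one poisson_eq)
  have "M - poisson h x \<noteq> 0"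
  proof
    assume "M - poisson h x = 0"
    then have "AE w in sphere_measure. poisson_kernel x w * (M - h w) = 0"
      using integral_nonneg_eq_0_iff_AE[OF I nn] eq by simp
    then have "AE w in sphere_measure. h w = M"
      using AE_sphere_norm
    proof eventually_elim
      case (elim w)
      then show ?case using poisson_kernel_pos[OF x, of w] by simp
    qed
    then have "(LINT w|sphere_measure. h w) = (LINT w|(sphere_measure :: (real^'n) measure). M)"
      by (intro integral_cong_AE) auto
    then show False using mean by (simp add: space_sphere_measure)
  qed
  moreover have "0 \<le> M - poisson h x" unfolding eq[symmetric] by (rule integral_nonneg_AE[OF nn])
  ultimately show ?thesis by simp
qed

section \<open>Orthogonal matrices on row vectors and the reduction to \<open>e0\<close> and
  \<open>north\<close>\<close>

lemma orthogonal_vector_matrix_inner: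
  fixes A :: "real^'n^'n"
  assumes "orthogonal_matrix A"
  shows "(x v* A) \<bullet> (y v* A) = x \<bullet> y"
  using orthogonal_vector_matrix[OF assms] by (simp add: orthogonal_transformation_def)

lemma vector_matrix_mul_transpose:
  fixes A :: "real^'n^'n"
  assumes "orthogonal_matrix A"
  shows "x v* A v* transpose A = x" "x v* transpose A v* A = x"
  using assms
  by (simp_all add: vector_matrix_mul_assoc orthogonal_matrix_def del: vector_transpose_matrix)

lemma matrix_inv_orthogonal:
  fixes A :: "real^'n^'n"
  assumes "orthogonal_matrix A"
  shows "matrix_inv A = transpose A"
proof -
  have *: "A ** transpose A = mat 1 \<and> transpose A ** A = mat 1"
    using assms by (simp add: orthogonal_matrix_def)
  then have "A ** matrix_inv A = mat 1"
    unfolding matrix_inv_def by (rule someI2) simp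
  then have "transpose A ** (A ** matrix_inv A) = transpose A" by simp
  with * show ?thesis by (simp add: matrix_mul_assoc)
qed

lemma bounded_linear_vector_matrix: "bounded_linear (\<lambda>x :: real^'n. x v* (A :: real^'k^'n))"
proof -
  have "(\<lambda>x. x v* A) = (*v) (transpose A)" by (simp add: fun_eq_iff)
  then show ?thesis by (simp only: matrix_vector_mul_bounded_linear)
qed

text \<open>\<open>A\<close> is absorbed by the rotation invariance of Poisson integrals,
  \<open>Q\<close> by their linearity.\<close>

lemma poisson_contraction_rotate:
  fixes F :: "real^'n \<Rightarrow> real^'k" and Q :: "real^'k^'k" and A :: "real^'n^'n"
  assumes F: "poisson_contraction F" and A: "orthogonal_matrix A" and Q: "orthogonal_matrix Q"
  shows "poisson_contraction (\<lambda>x. F (x v* A) v* Q)"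
proof -
  have TA: "orthogonal_transformation (\<lambda>x. x v* A)" and TQ: "orthogonal_transformation (\<lambda>x. x v* Q)"
    using A Q by (auto intro: orthogonal_vector_matrix)
  have nA: "norm (x v* A) = norm x" for x using TA by (simp add: orthogonal_transformation)
  have nQ: "norm (x v* Q) = norm x" for x using TQ by (simp add: orthogonal_transformation)
  have cA: "continuous_on S (\<lambda>x. x v* A)" for S by (rule linear_continuous_on[OF bounded_linear_vector_matrix])
  have cQ: "continuous_on S (\<lambda>x. x v* Q)" for S by (rule linear_continuous_on[OF bounded_linear_vector_matrix])
  have cF: "continuous_on (ball 0 1) F" and F1: "\<And>x. norm x < 1 \<Longrightarrow> norm (F x) < 1"
    and rep: "\<And>\<rho> x. 0 \<le> \<rho> \<Longrightarrow> \<rho> < 1 \<Longrightarrow> norm x < 1 \<Longrightarrow> poisson (\<lambda>w. F (\<rho> *\<^sub>R w)) x = F (\<rho> *\<^sub>R x)"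
    using F by (auto simp: poisson_contraction_def)
  have "continuous_on (ball 0 1) (\<lambda>x. F (x v* A) v* Q)"
    by (rule continuous_on_compose2[OF cQ[of UNIV] continuous_on_compose2[OF cF cA]]) (auto simp: nA)
  moreover have "poisson (\<lambda>w. F (\<rho> *\<^sub>R w v* A) v* Q) x = F (\<rho> *\<^sub>R x v* A) v* Q"
    if \<rho>: "0 \<le> \<rho>" "\<rho> < 1" and x: "norm x < 1" for \<rho> x
  proof -
    let ?g = "\<lambda>w. F (\<rho> *\<^sub>R w)"
    have m: "?g \<in> borel_measurable sphere_measure" and b: "AE w in sphere_measure. norm (?g w) \<le> 1"
      by (rule poisson_contraction_measurable[OF F \<rho>] poisson_contraction_bound[OF F \<rho>])+
    have lin: "\<rho> *\<^sub>R w v* A = \<rho> *\<^sub>R (w v* A)" for w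
      using linear_scale[OF orthogonal_transformation_linear[OF TA], of \<rho> w] .
    have gm: "(\<lambda>w. ?g (w v* A)) \<in> borel_measurable sphere_measure"
      by (rule measurable_compose[OF measurable_sphere_orthogonal[OF TA] m])
    have gb: "AE w in sphere_measure. norm (?g (w v* A)) \<le> 1"
      using AE_sphere_norm
    proof eventually_elim
      case (elim w)
      have "norm (\<rho> *\<^sub>R (w v* A)) < 1" using elim \<rho> by (intro norm_scaleR_less_one) (auto simp: nA)
      then show ?case using F1 less_imp_le by blast
    qed
    have "poisson (\<lambda>w. ?g (w v* A) v* Q) x = poisson (\<lambda>w. ?g (w v* A)) x v* Q"
      by (rule poisson_bounded_linear[OF bounded_linear_vector_matrix gm gb x])
    also have "poisson (\<lambda>w. ?g (w v* A)) x = poisson ?g (x v* A)"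
      by (rule poisson_orthogonal[OF TA m])
    also have "\<dots> = ?g (x v* A)" using x by (intro rep \<rho>) (simp add: nA)
    finally show ?thesis by (simp only: lin)
  qed
  ultimately show ?thesis using F1 by (simp add: poisson_contraction_def nA nQ)
qed

lemma harmonic_map_poisson_contraction:
  fixes F :: "real^'n \<Rightarrow> real^'k"
  assumes F: "harmonic_map_on (ball 0 1) F" and F1: "F ` ball 0 1 \<subseteq> ball 0 1"
  shows "poisson_contraction F"
proof -
  have "continuous_on (ball 0 1) (\<lambda>x. F x $ k)" for k
    using F by (simp add: harmonic_map_on_def C2_on_def differentiable_imp_continuous_on)
  then have "continuous_on (ball 0 1) F"
    using continuous_on_vec_lambda[of "ball 0 1" "\<lambda>k x. F x $ k"] by simp
  then show ?thesis
    using F1 harmonic_map_poisson[OF F] by (simp add: poisson_contraction_def image_subset_iff)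
qed

theorem theorem1:
  fixes F :: "real^'n::{finite,linorder} \<Rightarrow> real^('m::{finite,linorder} + 1)"
    and a :: "real^'m::{finite,linorder}" and b :: real
    and e :: "real^('m::{finite,linorder} + 1)"
    and Q :: "real^('m::{finite,linorder} + 1)^('m::{finite,linorder} + 1)"
  assumes "CARD('n) \<ge> 2"
    and "harmonic_map_on (ball 0 1) F"
    and "F ` ball 0 1 \<subseteq> ball 0 1"
    and "F 0 = join a b"
    and "norm e = 1"
    and "orthogonal_matrix Q"
    and "e v* Q = e0"
  shows "\<forall>r. 0 < r \<and> r < 1 \<longrightarrow>
      (\<forall>w \<in> sphere (0 :: real^'n::{finite,linorder}) 1.
         F (r *\<^sub>R w) \<bullet> e
           \<le> F_ext (join a b v* Q) r (r *\<^sub>R (north :: real^'n::{finite,linorder})) \<bullet> e0 \<and>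
         (\<forall>A. orthogonal_matrix A \<and> w v* A = north \<longrightarrow>
            (F (r *\<^sub>R w) \<bullet> e
               = F_ext (join a b v* Q) r (r *\<^sub>R (north :: real^'n::{finite,linorder})) \<bullet> e0 \<longleftrightarrow>
             (\<forall>x \<in> ball 0 1. F x = F_ext (join a b v* Q) r (x v* A) v* matrix_inv Q)))) \<and>
      (\<forall>x. norm x < r \<longrightarrow>
         F x \<bullet> e < F_ext (join a b v* Q) r (r *\<^sub>R (north :: real^'n::{finite,linorder})) \<bullet> e0)"
proof (intro allI impI)
  fix r :: real assume "0 < r \<and> r < 1"
  then have r: "0 < r" "r < 1" by auto
  let ?N = "north :: real^'n::_"
  define M where "M = F_ext (join a b v* Q) r (r *\<^sub>R ?N) \<bullet> e0"
  have F: "poisson_contraction F" by (rule harmonic_map_poisson_contraction[OF assms(2,3)])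
  have Fe: "F x \<bullet> e = (F x v* Q) \<bullet> e0" for x
    unfolding assms(7)[symmetric] by (simp add: orthogonal_vector_matrix_inner[OF assms(6)])
  \<comment> \<open>The rotated map has value \<open>join a b v* Q\<close> at 0, and its
    \<open>e0\<close>-component at \<open>r N\<close>, with \<open>N\<close> for
    \<open>north\<close>, is the \<open>e\<close>-component of \<open>F\<close> at
    \<open>r w\<close>; the special case applies to it.\<close>
  have rot: "poisson_contraction (\<lambda>x. F (x v* transpose A) v* Q)" if "orthogonal_matrix A" for A
    using that by (intro poisson_contraction_rotate F assms(6)) (simp add: orthogonal_matrix_transpose)
  have G0: "F (0 v* transpose A) v* Q = join a b v* Q" for A by (simp add: assms(4))
  have rw: "(r *\<^sub>R ?N) v* transpose A = r *\<^sub>R w" if "orthogonal_matrix A" "w v* A = ?N" for A w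
  proof -
    have "(r *\<^sub>R ?N) v* transpose A = r *\<^sub>R (?N v* transpose A)"
      using linear_scale[OF bounded_linear.linear[OF bounded_linear_vector_matrix]] .
    then show ?thesis using vector_matrix_mul_transpose(1)[OF that(1), of w] that(2) by simp
  qed
  have le: "F (r *\<^sub>R w) \<bullet> e \<le> M" if A: "orthogonal_matrix A" "w v* A = ?N" for A w
    using schwarz_pick_le[OF assms(1) r rot[OF A(1)]] unfolding G0 rw[OF A] M_def Fe .
  have ex: "\<exists>A. orthogonal_matrix A \<and> w v* A = ?N" if w: "norm w = 1" for w :: "real^'n::_"
  proof -
    \<comment> \<open>Some rotation carrying \<open>w\<close> to \<open>north\<close> must exist,
      since the inequality itself mentions none. \<open>B\<close> has \<open>w\<close> as its last
      column, so its transpose sends the row vector \<open>north\<close> to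
      \<open>w\<close>.\<close>
    obtain B where B: "orthogonal_matrix B" "B *v axis (Max UNIV) 1 = w"
      using orthogonal_matrix_exists_basis[OF w] by metis
    have "?N v* transpose B = w" using B(2) by (simp add: north_def)
    then have "w v* B = ?N" using vector_matrix_mul_transpose(2)[OF B(1), of ?N] by simp
    then show ?thesis using B(1) by blast
  qed
  have leM: "F (r *\<^sub>R w) \<bullet> e \<le> M" if "norm w = 1" for w using ex[OF that] le by blast
  have iff: "F (r *\<^sub>R w) \<bullet> e = M \<longleftrightarrow>
      (\<forall>x \<in> ball 0 1. F x = F_ext (join a b v* Q) r (x v* A) v* matrix_inv Q)"
    if w: "norm w = 1" and A: "orthogonal_matrix A" "w v* A = ?N" for w A
  proof
    have nA: "norm (x v* A) = norm x" for x
      using orthogonal_vector_matrix[OF A(1)] by (simp add: orthogonal_transformation)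
    assume eq: "F (r *\<^sub>R w) \<bullet> e = M"
    show "\<forall>x \<in> ball 0 1. F x = F_ext (join a b v* Q) r (x v* A) v* matrix_inv Q"
    proof
      fix x :: "real^'n::_" assume "x \<in> ball 0 1"
      then have x: "norm (x v* A) < 1" by (simp add: nA)
      have "F ((x v* A) v* transpose A) v* Q = F_ext (join a b v* Q) r (x v* A)"
        using schwarz_pick_unique[OF assms(1) r rot[OF A(1)] _ x] eq
        unfolding G0 rw[OF A] M_def Fe by blast
      then have "F x v* Q = F_ext (join a b v* Q) r (x v* A)"
        unfolding vector_matrix_mul_transpose(1)[OF A(1)] .
      then have "F x v* Q v* transpose Q = F_ext (join a b v* Q) r (x v* A) v* transpose Q" by simp
      then show "F x = F_ext (join a b v* Q) r (x v* A) v* matrix_inv Q"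
        unfolding vector_matrix_mul_transpose(1)[OF assms(6)] matrix_inv_orthogonal[OF assms(6)] .
    qed
  next
    assume *: "\<forall>x \<in> ball 0 1. F x = F_ext (join a b v* Q) r (x v* A) v* matrix_inv Q"
    have rA: "(r *\<^sub>R w) v* A = r *\<^sub>R ?N"
      using linear_scale[OF bounded_linear.linear[OF bounded_linear_vector_matrix]] A(2) by metis
    have "r *\<^sub>R w \<in> ball 0 1" using w r by simp
    then have "F (r *\<^sub>R w) = F_ext (join a b v* Q) r (r *\<^sub>R ?N) v* transpose Q"
      using * rA by (simp add: matrix_inv_orthogonal[OF assms(6)])
    then have "F (r *\<^sub>R w) v* Q = F_ext (join a b v* Q) r (r *\<^sub>R ?N)"
      by (simp only: vector_matrix_mul_transpose(2)[OF assms(6)])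
    then show "F (r *\<^sub>R w) \<bullet> e = M" by (simp only: Fe M_def)
  qed
  have less: "F x \<bullet> e < M" if x: "norm x < r" for x
  proof -
    \<comment> \<open>After rescaling, \<open>F x\<close> is the Poisson integral at
      \<open>?x\<close> of the values of \<open>F\<close> on the sphere of radius \<open>r\<close>,
      where the \<open>e\<close>-component is at most \<open>M\<close>.\<close>
    let ?x = "inverse r *\<^sub>R x"
    have nx: "norm ?x < 1" using x r by (simp add: field_simps)
    note Fm = poisson_contraction_measurable[OF F less_imp_le[OF r(1)] r(2)]
      and Fb = poisson_contraction_bound[OF F less_imp_le[OF r(1)] r(2)]
      and Fmean = poisson_contraction_mean[OF F less_imp_le[OF r(1)] r(2)]
    have hb: "AE w in sphere_measure. \<bar>F (r *\<^sub>R w) \<bullet> e\<bar> \<le> 1"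
      using Fb
    proof eventually_elim
      case (elim w)
      then show ?case using Cauchy_Schwarz_ineq2[of "F (r *\<^sub>R w)" e] assms(5) by simp
    qed
    have "poisson (\<lambda>w. F (r *\<^sub>R w) \<bullet> e) ?x < M"
    proof (rule poisson_less[OF _ hb _ _ nx])
      show "(\<lambda>w. F (r *\<^sub>R w) \<bullet> e) \<in> borel_measurable sphere_measure" using Fm by simp
      show "AE w in sphere_measure. F (r *\<^sub>R w) \<bullet> e \<le> M"
        using AE_sphere_norm by eventually_elim (rule leM)
      have "(LINT w|sphere_measure. F (r *\<^sub>R w) \<bullet> e) = F 0 \<bullet> e"
        using sphere.integrable_const_bound[OF Fb Fm] Fmean by simp
      also have "\<dots> < M"
        using schwarz_pick_centre[OF assms(1) r rot[of "mat 1"]]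
        unfolding G0 M_def Fe by (simp add: assms(4) orthogonal_matrix_id)
      finally show "(LINT w|sphere_measure. F (r *\<^sub>R w) \<bullet> e) < M" .
    qed
    also have "poisson (\<lambda>w. F (r *\<^sub>R w) \<bullet> e) ?x = poisson (\<lambda>w. F (r *\<^sub>R w)) ?x \<bullet> e"
      by (rule poisson_bounded_linear[OF bounded_linear_inner_left Fm Fb nx])
    also have "poisson (\<lambda>w. F (r *\<^sub>R w)) ?x = F (r *\<^sub>R ?x)"
      using F r nx by (simp add: poisson_contraction_def)
    finally show ?thesis using r by simp
  qed
  show "(\<forall>w \<in> sphere (0 :: real^'n::_) 1.
         F (r *\<^sub>R w) \<bullet> e
           \<le> F_ext (join a b v* Q) r (r *\<^sub>R ?N) \<bullet> e0 \<and>
         (\<forall>A. orthogonal_matrix A \<and> w v* A = north \<longrightarrow>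
            (F (r *\<^sub>R w) \<bullet> e
               = F_ext (join a b v* Q) r (r *\<^sub>R ?N) \<bullet> e0 \<longleftrightarrow>
             (\<forall>x \<in> ball 0 1. F x = F_ext (join a b v* Q) r (x v* A) v* matrix_inv Q)))) \<and>
      (\<forall>x. norm x < r \<longrightarrow>
         F x \<bullet> e < F_ext (join a b v* Q) r (r *\<^sub>R ?N) \<bullet> e0)"
    using leM iff less unfolding M_def[symmetric] by auto
qed

end
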